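(* There exist universal constants $C,C'>0$ such that the following holds. Let $0<q<1$, $\alpha>0$, and $m,s\in\mathbb{N}$ satisfy $$m\ge C\alpha^{-1}\Big(\frac1q-\frac12\Big)s\log^4(s),$$ and set $N=\lceil s^{(1/q-1/2)/\alpha}\rceil$. Then there exist sampling points $x_1,\dots,x_m\in[-1,1]$ and a reconstruction map $R$ assigning to each vector in $\mathbb{R}^m$ a polynomial of degree at most $N$, such that for every $f\in A_q\cap A_{1,\alpha}$ the polynomial $P=R(f(x_1),\dots,f(x_m))$ satisfies $$\frac{1}{\sqrt3}\|f-P\|_{\infty,w}\le\|f-P\|_{A_1}\le C'\big(\|f\|_{A_q}+\|f\|_{A_{1,\alpha}}\big)s^{1-1/q}.$$
   Context: $L_k$ denotes the Legendre polynomial of degree $k$ normalized so that $\frac12\int_{-1}^1L_kL_\ell\,dx=\delta_{k,\ell}$. For $f\in C[-1,1]$, its Fourier–Legendre coefficients are $c_k(f)=\frac12\int_{-1}^1f(x)L_k(x)\,dx$, $k\in\mathbb{N}_0$, and $c(f)=(c_k(f))_{k\ge0}$. For $0<p\le1$, $A_p=\{f\in C[-1,1]:\|c(f)\|_p<\infty\}$ with $\|f\|_{A_p}=\|c(f)\|_p=(\sum_k|c_k(f)|^p)^{1/p}$. For $\alpha>0$, $A_{1,\alpha}$ is the set of $f\in C[-1,1]$ with $\|f\|_{A_{1,\alpha}}=\sum_{k\ge0}(1+k)^\alpha|c_k(f)|<\infty$. With $w(x)=\sqrt{\pi/2}\,(1-x^2)^{1/4}$, $\|f\|_{\infty,w}=\sup_{x\in[-1,1]}|f(x)|w(x)$.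 *)

theory Defs
  imports "HOL-Analysis.Analysis" "HOL-Computational_Algebra.Polynomial"
begin

fun legendreP :: "nat \<Rightarrow> real \<Rightarrow> real" where
  "legendreP 0 x = 1"
| "legendreP (Suc 0) x = x"
| "legendreP (Suc (Suc k)) x =
     ((2 * real k + 3) * x * legendreP (Suc k) x - (real k + 1) * legendreP k x) / (real k + 2)"

text \<open>Normalized Legendre polynomials: (1/2) int_{-1}^1 L_k L_l = delta_{kl}.\<close>
definition legendreL :: "nat \<Rightarrow> real \<Rightarrow> real" where
  "legendreL k x = sqrt (2 * real k + 1) * legendreP k x"

definition flcoeff :: "(real \<Rightarrow> real) \<Rightarrow> nat \<Rightarrow> real" where
  "flcoeff f k = (1/2) * integral {-1..1} (\<lambda>x. f x * legendreL k x)"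

definition A_space :: "real \<Rightarrow> (real \<Rightarrow> real) set" where
  "A_space p = {f. continuous_on {-1..1} f \<and> summable (\<lambda>k. \<bar>flcoeff f k\<bar> powr p)}"

definition A_norm :: "real \<Rightarrow> (real \<Rightarrow> real) \<Rightarrow> real" where
  "A_norm p f = (\<Sum>k. \<bar>flcoeff f k\<bar> powr p) powr (1 / p)"

definition A1w_space :: "real \<Rightarrow> (real \<Rightarrow> real) set" where
  "A1w_space \<alpha> = {f. continuous_on {-1..1} f \<and>
      summable (\<lambda>k. (1 + real k) powr \<alpha> * \<bar>flcoeff f k\<bar>)}"

definition A1w_norm :: "real \<Rightarrow> (real \<Rightarrow> real) \<Rightarrow> real" where
  "A1w_norm \<alpha> f = (\<Sum>k. (1 + real k) powr \<alpha> * \<bar>flcoeff f k\<bar>)"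

definition wgt :: "real \<Rightarrow> real" where
  "wgt x = sqrt (pi / 2) * (1 - x\<^sup>2) powr (1/4)"

definition wsup_norm :: "(real \<Rightarrow> real) \<Rightarrow> real" where
  "wsup_norm f = (SUP x\<in>{-1..1}. \<bar>f x\<bar> * wgt x)"

end

theory Submission
  imports Defs "HOL-Probability.Probability_Measure"
begin

text \<open>Put \<open>\<phi>\<^sub>k = w L\<^sub>k\<close>. Under \<open>x = - cos \<theta>\<close> with \<open>\<theta>\<close> uniform on \<open>[0, \<pi>]\<close> the \<open>\<phi>\<^sub>k\<close> are orthonormal, and
  Sonin's monotone energy gives \<open>\<bar>\<phi>\<^sub>k\<bar> \<le> \<surd>3\<close>. For recovery by \<open>l\<^sub>1\<close>-minimisation no restricted isometry
  property is needed: it suffices that every \<open>c\<close> with \<open>\<parallel>c\<parallel>\<^sub>1 \<le> 4 \<surd>s \<parallel>c\<parallel>\<^sub>2\<close> satisfies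
  \<open>\<bar>F c (x\<^sub>j)\<bar> \<ge> \<kappa> \<parallel>c\<parallel>\<^sub>2\<close> for at least one sampling point, where \<open>F c = \<Sum> c\<^sub>k \<phi>\<^sub>k\<close>, because the tail of \<open>f\<close>
  is small in the weighted supremum norm.

  To find such points, normalise \<open>\<parallel>c\<parallel>\<^sub>2 = 1\<close>. As \<open>F c\<close> is bounded by a multiple of \<open>\<surd>s\<close>, some dyadic level \<open>T\<close>
  satisfies \<open>P(\<bar>F c\<bar> \<ge> T) \<ge> const / (T\<^sup>2 log s)\<close>. Maurey's method replaces \<open>F c\<close> by an average of about
  \<open>s log s / T\<^sup>2\<close> functions \<open>\<plusminus>4 \<surd>s \<phi>\<^sub>k\<close>, up to an error \<open>T / 4\<close> outside a set that is negligible both for the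
  underlying measure and for the empirical measure of the sampling points. The union bound therefore runs
  over finitely many averages only, and the factor \<open>T\<^sup>2\<close> cancels between the logarithm of their number and
  the hitting probability.\<close>

section \<open>Legendre polynomials and the weighted uniform bound\<close>

text \<open>The points must be fixed before the coefficient vector, yet the Maurey list
  approximating \<open>F c\<close> depends on \<open>c\<close> and on the points. This is not
  circular: the union bound covers every list whose own average is large with sufficient
  probability, so any list selected later was provided for. Controlling the error under the
  empirical measure ensures that the points hitting the average are not all exceptional. One
  logarithm pays for the dyadic levels, one for making the exceptional set small compared with the
  hitting probability, and \<open>ln (2 * (N + 1))\<close> for the number of functions; the last is
  of order \<open>t * ln s\<close> with \<open>t = (1/q - 1/2) / \<alpha>\<close>, whence the factor
  \<open>t\<close> in the hypothesis. When \<open>s powr t\<close> is near 1 that comparison breaks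
  down, because \<open>ln (2 * (N + 1))\<close> stays away from 0. \<open>N\<close> is chosen so
  that \<open>sqrt s\<close> times the coefficient tail is at most \<open>s powr (1 - 1/q)\<close>
  times \<open>A1w_norm\<close>; the factor \<open>sqrt s\<close> is the price of passing from noise
  in the supremum norm to an error in the \<open>l1\<close> norm.\<close>

fun legendreD :: "nat \<Rightarrow> real \<Rightarrow> real" where
  "legendreD 0 x = 0"
| "legendreD (Suc n) x = x * legendreD n x + (real n + 1) * legendreP n x"

section \<open>Derivative identities, orthogonality and norms\<close>

lemma legendreP_rec:
  "(real n + 2) * legendreP (Suc (Suc n)) x =
     (2 * real n + 3) * x * legendreP (Suc n) x - (real n + 1) * legendreP n x"
  by simp

text \<open>Companion of the recursion defining \<open>legendreD\<close>: eliminating one of the two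
  derivatives from the pair gives \<open>legendreD_weighted\<close>, and differentiating the
  three-term recurrence is consistent with \<open>legendreD\<close> because of it.\<close>

lemma legendreD_lower:
  "x * legendreD (Suc n) x - legendreD n x = (real n + 1) * legendreP (Suc n) x"
proof (induction n)
  case 0
  then show ?case by simp
next
  case (Suc n)
  have 1: "legendreD (Suc n) x = x * legendreD n x + (real n + 1) * legendreP n x"
    by simp
  have 2: "legendreD (Suc (Suc n)) x = x * legendreD (Suc n) x + (real n + 2) * legendreP (Suc n) x"
    by simp
  have 3: "(real (Suc n) + 1) * legendreP (Suc (Suc n)) x =
     (2 * real n + 3) * x * legendreP (Suc n) x - (real n + 1) * legendreP n x"
    using legendreP_rec[of n x] by (simp add: add.commute)
  show ?case unfolding 2 3 using Suc.IH 1 by algebra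
qed

lemma legendreD_weighted:
  "(1 - x\<^sup>2) * legendreD (Suc n) x = (real n + 1) * (legendreP n x - x * legendreP (Suc n) x)"
proof -
  have 1: "legendreD (Suc n) x = x * legendreD n x + (real n + 1) * legendreP n x"
    by simp
  show ?thesis using legendreD_lower[of x n] 1 by algebra
qed

lemma legendreP_has_derivative:
  "(legendreP n has_real_derivative legendreD n x) (at x within A)"
proof (induction n x rule: legendreP.induct)
  case (1 x)
  have "legendreP 0 = (\<lambda>_. 1)" by auto
  then show ?case by simp
next
  case (2 x)
  have "legendreP (Suc 0) = (\<lambda>x. x)" by auto
  then show ?case by simp
next
  case (3 k x)
  have eq: "legendreP (Suc (Suc k)) = (\<lambda>x. ((2 * real k + 3) * x * legendreP (Suc k) x
      - (real k + 1) * legendreP k x) / (real k + 2))"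
    by auto
  have "((\<lambda>x. ((2 * real k + 3) * x * legendreP (Suc k) x - (real k + 1) * legendreP k x)
       / (real k + 2)) has_real_derivative
     ((2 * real k + 3) * (legendreP (Suc k) x + x * legendreD (Suc k) x)
        - (real k + 1) * legendreD k x) / (real k + 2)) (at x within A)"
    by (rule DERIV_cong, rule derivative_eq_intros 3 refl | simp del: legendreP.simps legendreD.simps)+
       (simp add: algebra_simps del: legendreP.simps legendreD.simps)
  also have "((2 * real k + 3) * (legendreP (Suc k) x + x * legendreD (Suc k) x)
        - (real k + 1) * legendreD k x) / (real k + 2) = legendreD (Suc (Suc k)) x"
  proof -
    have "(2 * real k + 3) * (legendreP (Suc k) x + x * legendreD (Suc k) x)
        - (real k + 1) * legendreD k x = (real k + 2) * legendreD (Suc (Suc k)) x"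
    proof -
      have 2: "legendreD (Suc (Suc k)) x =
          x * legendreD (Suc k) x + (real k + 2) * legendreP (Suc k) x"
        by simp
      show ?thesis unfolding 2 using legendreD_lower[of x k] by algebra
    qed
    then show ?thesis by (simp add: nonzero_divide_eq_eq del: legendreD.simps)
  qed
  finally show ?case unfolding eq .
qed

text \<open>Legendre's equation in self-adjoint form: differentiate
  \<open>legendreD_weighted\<close> and apply \<open>legendreD_lower\<close>. This form makes
  orthogonality a matter of an explicit antiderivative.\<close>

lemma legendre_ode:
  "((\<lambda>x. (1 - x\<^sup>2) * legendreD n x) has_real_derivative - (real n * (real n + 1)) * legendreP n x)
     (at x within A)"
proof (cases n)
  case 0
  then have "(\<lambda>x. (1 - x\<^sup>2) * legendreD n x) = (\<lambda>x. 0)" by auto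
  then show ?thesis using 0 by simp
next
  case (Suc k)
  have "((\<lambda>x. (real k + 1) * (legendreP k x - x * legendreP (Suc k) x)) has_real_derivative
     (real k + 1) * (legendreD k x - (legendreP (Suc k) x + x * legendreD (Suc k) x)))
     (at x within A)"
    by (rule derivative_eq_intros legendreP_has_derivative refl | simp)+
  moreover have "(real k + 1) * (legendreD k x - (legendreP (Suc k) x + x * legendreD (Suc k) x))
     = - (real n * (real n + 1)) * legendreP n x"
  proof -
    have "legendreD k x = x * legendreD (Suc k) x - (real k + 1) * legendreP (Suc k) x"
      using legendreD_lower[of x k] by linarith
    then show ?thesis unfolding Suc of_nat_Suc by algebra
  qed
  ultimately show ?thesis unfolding Suc legendreD_weighted by simp
qed

lemma continuous_on_legendreP [continuous_intros]: "continuous_on A (legendreP n)"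
  using legendreP_has_derivative by (meson DERIV_continuous_on)

lemma legendreP_minus: "legendreP n (- x) = (- 1) ^ n * legendreP n x"
  by (induction n x rule: legendreP.induct) (auto simp: field_simps)

lemma legendreP_orthogonal:
  assumes "n \<noteq> k"
  shows "((\<lambda>x. legendreP n x * legendreP k x) has_integral 0) {-1..1}"
proof -
  define c where "c = real n * (real n + 1) - real k * (real k + 1)"
  have c: "c \<noteq> 0"
  proof -
    have "c = (real n - real k) * (real n + real k + 1)" by (simp add: c_def algebra_simps)
    moreover have "real n + real k + 1 > 0" by linarith
    ultimately show ?thesis using assms by simp
  qed
  \<comment> \<open>The Wronskian \<open>(1 - x^2) (P_n P_k' - P_k P_n')\<close> is an
    antiderivative that vanishes at both end points.\<close>
  have d: "((\<lambda>x. legendreP n x * ((1 - x\<^sup>2) * legendreD k x) - legendreP k x * ((1 - x\<^sup>2) * legendreD n x))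
     has_real_derivative c * (legendreP n x * legendreP k x)) (at x within {-1..1})" for x
    by (rule derivative_eq_intros legendreP_has_derivative legendre_ode refl
        | simp add: c_def algebra_simps)+
  have "((\<lambda>x. c * (legendreP n x * legendreP k x)) has_integral 0) {-1..1}"
    using fundamental_theorem_of_calculus[of "-1" 1, OF _ d[unfolded has_real_derivative_iff_has_vector_derivative]]
    by simp
  then have "((\<lambda>x. (1/c) * (c * (legendreP n x * legendreP k x))) has_integral (1/c) * 0) {-1..1}"
    by (rule has_integral_mult_right)
  then show ?thesis using c by simp
qed

lemma legendreP_integrable [simp]:
  "(\<lambda>x. legendreP n x * legendreP k x) integrable_on {-1..1}"
  "(\<lambda>x. x * legendreP n x * legendreP k x) integrable_on {-1..1}"
  by (intro integrable_continuous_real continuous_intros)+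

text \<open>The recurrence for degree n + 2 tested against \<open>P_n\<close> (\<open>up\<close>)
  and the recurrence for degree n + 1 tested against \<open>P_(n+1)\<close> (\<open>low\<close>)
  both evaluate the integral of \<open>x P_n P_(n+1)\<close>; equating them gives the ratio of
  consecutive square norms.\<close>

lemma legendreP_square_integral:
  "integral {-1..1} (\<lambda>x. legendreP n x * legendreP n x) = 2 / (2 * real n + 1)"
proof (induction n)
  case 0
  then show ?case by simp
next
  case (Suc n)
  let ?I = "\<lambda>n k. integral {-1..1} (\<lambda>x. legendreP n x * legendreP k x)"
  let ?X = "\<lambda>n k. integral {-1..1} (\<lambda>x. x * legendreP n x * legendreP k x)"
  have orth: "?I i j = 0" if "i \<noteq> j" for i j
    using legendreP_orthogonal[OF that] by blast
  have rec: "(real k + 2) * ?I (Suc (Suc k)) j = (2 * real k + 3) * ?X (Suc k) j - (real k + 1) * ?I k j"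
    for k j
  proof -
    have "(real k + 2) * ?I (Suc (Suc k)) j =
        integral {-1..1} (\<lambda>x. (real k + 2) * (legendreP (Suc (Suc k)) x * legendreP j x))"
      by simp
    also have "\<dots> = integral {-1..1} (\<lambda>x. (2 * real k + 3) * (x * legendreP (Suc k) x * legendreP j x)
        - (real k + 1) * (legendreP k x * legendreP j x))"
    proof (rule integral_cong)
      fix x show "(real k + 2) * (legendreP (Suc (Suc k)) x * legendreP j x) =
        (2 * real k + 3) * (x * legendreP (Suc k) x * legendreP j x)
        - (real k + 1) * (legendreP k x * legendreP j x)"
        using legendreP_rec[of k x] by algebra
    qed
    also have "\<dots> = (2 * real k + 3) * ?X (Suc k) j - (real k + 1) * ?I k j"
      by (subst integral_diff) (auto intro!: integrable_on_mult_right)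
    finally show ?thesis .
  qed
  have sym: "?X (Suc n) n = ?X n (Suc n)"
    by (rule integral_cong) simp
  have up: "(2 * real n + 3) * ?X (Suc n) n = (real n + 1) * ?I n n"
    using rec[of n n] orth[of "Suc (Suc n)" n] by simp
  have low: "(real n + 1) * ?I (Suc n) (Suc n) = (2 * real n + 1) * ?X n (Suc n)"
  proof (cases n)
    case 0
    then show ?thesis by (simp)
  next
    case (Suc k)
    have "(real k + 2) * ?I n' n' = (2 * real k + 3) * ?X (Suc k) n'" if "n' = Suc (Suc k)" for n'
      using rec[of k n'] orth[of k n'] that by simp
    then show ?thesis using Suc by (simp add: algebra_simps del: legendreP.simps)
  qed
  have "?X (Suc n) n = (real n + 1) * (2 / (2 * real n + 1)) / (2 * real n + 3)"
    using up unfolding Suc by (metis nonzero_mult_div_cancel_left add_nonneg_eq_0_iff mult_nonneg_nonneg of_nat_0_le_iff zero_le_numeral zero_neq_numeral)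
  moreover have "(2 * real n + 1) * ((real n + 1) * (2 / (2 * real n + 1)) / (2 * real n + 3)) =
      (real n + 1) * (2 / (2 * real n + 3))"
    by (simp add: divide_simps)
  ultimately have "(real n + 1) * ?I (Suc n) (Suc n) = (real n + 1) * (2 / (2 * real n + 3))"
    using low sym by simp
  then have "?I (Suc n) (Suc n) = 2 / (2 * real n + 3)"
    by (subst (asm) mult_cancel_left) linarith
  then show ?case by (simp add: algebra_simps del: legendreP.simps)
qed

lemma legendreL_integral:
  "integral {-1..1} (\<lambda>x. legendreL n x * legendreL k x) = (if n = k then 2 else 0)"
proof -
  have "integral {-1..1} (\<lambda>x. legendreL n x * legendreL k x) =
     integral {-1..1} (\<lambda>x. (sqrt (2 * real n + 1) * sqrt (2 * real k + 1)) * (legendreP n x * legendreP k x))"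
    by (rule integral_cong) (simp add: legendreL_def)
  also have "\<dots> = (sqrt (2 * real n + 1) * sqrt (2 * real k + 1)) *
      integral {-1..1} (\<lambda>x. legendreP n x * legendreP k x)"
    by simp
  also have "\<dots> = (if n = k then 2 else 0)"
    using legendreP_orthogonal[of n k, THEN integral_unique] legendreP_square_integral[of n]
    by (auto simp: divide_simps mult.commute)
  finally show ?thesis .
qed

section \<open>Bernstein's inequality via Sonin's energy\<close>

lemma legendreP_zero_even:
  assumes "k \<ge> 1"
  shows "(legendreP (2 * k) 0)\<^sup>2 * (2 * real k + 1) \<le> 3 / 4"
  using assms
proof (induction k rule: dec_induct)
  case base
  then show ?case by (simp add: numeral_eq_Suc power2_eq_square)
next
  case (step k)
  define y where "y = (legendreP (2 * k) 0)\<^sup>2"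
  have "legendreP (2 * Suc k) 0 = - ((2 * real k + 1) / (2 * real k + 2)) * legendreP (2 * k) 0"
    by (simp add: divide_simps)
  then have "(legendreP (2 * Suc k) 0)\<^sup>2 = ((2 * real k + 1) / (2 * real k + 2))\<^sup>2 * y"
    unfolding y_def by (simp only: power_mult_distrib) simp
  \<comment> \<open>Since \<open>(2k+1)(2k+3)\<close> is below \<open>(2k+2)^2\<close>, the bounded
    quantity decreases in \<open>k\<close> from its value 3/4 at \<open>k = 1\<close>; at
    \<open>k = 0\<close> it would be 1.\<close>
  moreover have "((2 * real k + 1) / (2 * real k + 2))\<^sup>2 * (2 * real k + 3) \<le> 2 * real k + 1"
  proof -
    have "(2 * real k + 1)\<^sup>2 * (2 * real k + 3) \<le> (2 * real k + 1) * (2 * real k + 2)\<^sup>2"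
      by (simp add: power2_eq_square algebra_simps)
    then show ?thesis by (simp add: power_divide divide_simps)
  qed
  then have "((2 * real k + 1) / (2 * real k + 2))\<^sup>2 * (2 * real k + 3) * y \<le> (2 * real k + 1) * y"
    by (rule mult_right_mono) (simp add: y_def)
  ultimately show ?case using step.IH unfolding y_def
    by (simp add: algebra_simps del: legendreP.simps)
qed

lemma legendreP_zero_odd: "legendreP (Suc (2 * k)) 0 = 0"
  using legendreP_minus[of "Suc (2 * k)" 0] by simp

text \<open>With \<open>x = cos \<theta>\<close> the function \<open>u = (sin \<theta>)\<^sup>1\<^sup>/\<^sup>2 P\<^sub>n(cos \<theta>)\<close> solves \<open>u'' + \<phi> u = 0\<close> with
  \<open>\<phi> = (n + 1/2)\<^sup>2 + 1 / (4 sin\<^sup>2 \<theta>)\<close>, and the Sonin energy below is \<open>u\<^sup>2 + u'\<^sup>2 / \<phi>\<close>; it is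
  monotone because \<open>\<phi>\<close> is.\<close>

definition legendre_energy :: "nat \<Rightarrow> real \<Rightarrow> real" where
  "legendre_energy n x = sqrt (1 - x\<^sup>2) *
     ((legendreP n x)\<^sup>2 + 4 * ((1 - x\<^sup>2) * legendreD n x - x * legendreP n x / 2)\<^sup>2 /
        ((2 * real n + 1)\<^sup>2 * (1 - x\<^sup>2) + 1))"

lemma legendre_energy_derivative:
  assumes "\<bar>x\<bar> < 1"
  shows "(legendre_energy n has_real_derivative
    - (8 * x * ((1 - x\<^sup>2) * legendreD n x - x * legendreP n x / 2)\<^sup>2 /
        (sqrt (1 - x\<^sup>2) * ((2 * real n + 1)\<^sup>2 * (1 - x\<^sup>2) + 1)\<^sup>2))) (at x)"
proof -
  define r where "r = 1 - x\<^sup>2"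
  define y where "y = legendreP n x"
  define d where "d = legendreD n x"
  define z where "z = r * d - x * y / 2"
  define Q where "Q = (2 * real n + 1)\<^sup>2 * r + 1"
  define z' where "z' = - (real n * (real n + 1)) * y - (y + x * d) / 2"
  define \<rho> where "\<rho> = sqrt r"
  have r: "r > 0" using assms by (simp add: r_def abs_square_less_1)
  then have \<rho>: "\<rho> > 0" "\<rho>\<^sup>2 = r" by (auto simp: \<rho>_def)
  have Q: "Q > 0" using r by (simp add: Q_def add_nonneg_pos)
  have dz: "((\<lambda>x. (1 - x\<^sup>2) * legendreD n x - x * legendreP n x / 2) has_real_derivative z') (at x)"
    by (rule DERIV_cong, (rule derivative_eq_intros legendre_ode legendreP_has_derivative refl | simp)+)
       (simp add: z'_def y_def d_def algebra_simps)
  have dy2: "((\<lambda>x. (legendreP n x)\<^sup>2) has_real_derivative 2 * y * d) (at x)"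
    by (rule DERIV_cong, (rule derivative_eq_intros legendreP_has_derivative refl | simp)+)
       (simp add: y_def d_def)
  have dz2: "((\<lambda>x. 4 * ((1 - x\<^sup>2) * legendreD n x - x * legendreP n x / 2)\<^sup>2)
      has_real_derivative 8 * z * z') (at x)"
    by (rule DERIV_cong, (rule derivative_eq_intros dz refl | simp)+)
       (simp add: z_def r_def y_def d_def)
  have dQ: "((\<lambda>x. (2 * real n + 1)\<^sup>2 * (1 - x\<^sup>2) + 1) has_real_derivative
      - (2 * x * (2 * real n + 1)\<^sup>2)) (at x)"
    by (auto intro!: derivative_eq_intros)
  have dr: "((\<lambda>x. sqrt (1 - x\<^sup>2)) has_real_derivative - x / \<rho>) (at x)"
    using r unfolding r_def \<rho>_def by (auto intro!: derivative_eq_intros simp: divide_simps)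
  have dfrac: "((\<lambda>x. 4 * ((1 - x\<^sup>2) * legendreD n x - x * legendreP n x / 2)\<^sup>2 /
        ((2 * real n + 1)\<^sup>2 * (1 - x\<^sup>2) + 1)) has_real_derivative
      (8 * z * z' * Q + 4 * z\<^sup>2 * (2 * x * (2 * real n + 1)\<^sup>2)) / (Q * Q)) (at x)"
    by (rule DERIV_cong[OF DERIV_divide[OF dz2 dQ]])
       (use Q in \<open>auto simp: z_def Q_def r_def y_def d_def\<close>)
  have "(legendre_energy n has_real_derivative
     - x / \<rho> * (y\<^sup>2 + 4 * z\<^sup>2 / Q) +
     (2 * y * d + (8 * z * z' * Q + 4 * z\<^sup>2 * (2 * x * (2 * real n + 1)\<^sup>2)) / (Q * Q)) * \<rho>) (at x)"
    unfolding legendre_energy_def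
    by (rule DERIV_cong[OF DERIV_mult[OF dr DERIV_add[OF dy2 dfrac]]])
       (simp add: z_def Q_def r_def y_def d_def \<rho>_def)
  also have "- x / \<rho> * (y\<^sup>2 + 4 * z\<^sup>2 / Q) +
     (2 * y * d + (8 * z * z' * Q + 4 * z\<^sup>2 * (2 * x * (2 * real n + 1)\<^sup>2)) / (Q * Q)) * \<rho>
     = - (8 * x * z\<^sup>2 / (\<rho> * Q\<^sup>2))"
  proof -
    \<comment> \<open>\<open>e1\<close> to \<open>e3\<close> remove \<open>d\<close>,
      \<open>z'\<close> and the square of 2n + 1 in favour of \<open>y\<close>, \<open>z\<close> and
      \<open>Q\<close>; \<open>e2\<close> carries the differential equation. After that all terms
      but one cancel.\<close>
    have e1: "2 * y * (r * d) = 2 * y * z + x * y\<^sup>2"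
      by (simp add: z_def algebra_simps power2_eq_square)
    have e2: "4 * (r * z') = - (y * Q) - 2 * x * z"
      unfolding z'_def z_def Q_def r_def by (simp add: field_simps power2_eq_square)
    have e3: "(2 * real n + 1)\<^sup>2 * r = Q - 1" by (simp add: Q_def)
    have "- x * (y\<^sup>2 * Q\<^sup>2 + 4 * z\<^sup>2 * Q) + r * (2 * y * d * Q\<^sup>2 + (8 * z * z' * Q +
        4 * z\<^sup>2 * (2 * x * (2 * real n + 1)\<^sup>2))) =
       - x * (y\<^sup>2 * Q\<^sup>2 + 4 * z\<^sup>2 * Q) + (2 * y * (r * d)) * Q\<^sup>2 + 2 * z * Q * (4 * (r * z')) +
        8 * x * z\<^sup>2 * ((2 * real n + 1)\<^sup>2 * r)"
      by algebra
    also have "\<dots> = - (8 * x * z\<^sup>2)"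
      unfolding e1 e2 e3 by algebra
    finally have key: "- x * (y\<^sup>2 * Q\<^sup>2 + 4 * z\<^sup>2 * Q) + r * (2 * y * d * Q\<^sup>2 + (8 * z * z' * Q +
        4 * z\<^sup>2 * (2 * x * (2 * real n + 1)\<^sup>2))) = - (8 * x * z\<^sup>2)" .
    have "- x / \<rho> * (y\<^sup>2 + 4 * z\<^sup>2 / Q) +
     (2 * y * d + (8 * z * z' * Q + 4 * z\<^sup>2 * (2 * x * (2 * real n + 1)\<^sup>2)) / (Q * Q)) * \<rho>
     = (- x * (y\<^sup>2 * Q\<^sup>2 + 4 * z\<^sup>2 * Q) + \<rho>\<^sup>2 * (2 * y * d * Q\<^sup>2 + (8 * z * z' * Q +
        4 * z\<^sup>2 * (2 * x * (2 * real n + 1)\<^sup>2)))) / (\<rho> * Q\<^sup>2)"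
      using \<rho>(1) Q by (simp add: field_simps power2_eq_square)
    then show ?thesis unfolding \<rho>(2) key by simp
  qed
  finally show ?thesis by (simp add: z_def Q_def r_def y_def d_def \<rho>_def)
qed

text \<open>At 0 parity leaves only one of the two energy terms: the value for even n, the
  derivative \<open>n P_(n-1)(0)\<close> for odd n, so \<open>legendreP_zero_even\<close> serves
  both. The case n = 1 is separate because it involves \<open>P_0(0) = 1\<close>, which that lemma
  excludes.\<close>

lemma legendre_energy_zero:
  assumes "n \<ge> 1"
  shows "(2 * real n + 1) * legendre_energy n 0 \<le> 3 / 2"
proof -
  have E: "legendre_energy n 0 = (legendreP n 0)\<^sup>2 + 4 * (legendreD n 0)\<^sup>2 / ((2 * real n + 1)\<^sup>2 + 1)"
    by (simp add: legendre_energy_def)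
  show ?thesis
  proof (cases "even n")
    case True
    then obtain k where n: "n = 2 * k" by blast
    with assms obtain j where j: "n = Suc (Suc (2 * j))" and k: "k \<ge> 1"
      by (cases k) auto
    have "legendreD n 0 = 0"
      unfolding j by (subst legendreD.simps) (simp only: legendreP_zero_odd mult_zero_left mult_zero_right add_0)
    then have "(2 * real n + 1) * legendre_energy n 0 = (4 * real k + 1) * (legendreP (2 * k) 0)\<^sup>2"
      unfolding E[unfolded n] n by simp
    also have "\<dots> \<le> 2 * ((2 * real k + 1) * (legendreP (2 * k) 0)\<^sup>2)"
      by (simp add: algebra_simps)
    also have "\<dots> \<le> 3 / 2" using legendreP_zero_even[OF k] by (simp add: mult.commute)
    finally show ?thesis .
  next
    case False
    then obtain k where n: "n = Suc (2 * k)" by (metis oddE Suc_eq_plus1)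
    define y where "y = (legendreP (2 * k) 0)\<^sup>2"
    have y: "y \<ge> 0" by (simp add: y_def)
    have D: "(legendreD n 0)\<^sup>2 = (real n)\<^sup>2 * y"
      unfolding n y_def by (simp add: power_mult_distrib add.commute)
    have eq: "(2 * real n + 1) * legendre_energy n 0 =
        4 * (2 * real n + 1) * (real n)\<^sup>2 * y / ((2 * real n + 1)\<^sup>2 + 1)"
      unfolding E D by (simp add: n legendreP_zero_odd del: legendreP.simps)
    have pos: "(2 * real n + 1)\<^sup>2 + 1 > 0" by (simp add: add_nonneg_pos)
    show ?thesis
    proof (cases "k = 0")
      case True
      then show ?thesis unfolding eq by (simp add: n y_def)
    next
      case False
      then have "y * real n \<le> 3 / 4" using legendreP_zero_even[of k] by (simp add: y_def n add.commute)
      then have "(4 * (2 * real n + 1) * real n) * (y * real n) \<le> (4 * (2 * real n + 1) * real n) * (3 / 4)"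
        by (rule mult_left_mono) simp
      also have "\<dots> \<le> 3 / 2 * ((2 * real n + 1)\<^sup>2 + 1)"
        by (simp add: power2_eq_square algebra_simps)
      finally show ?thesis unfolding eq using pos
        by (simp add: pos_divide_le_eq power2_eq_square algebra_simps)
    qed
  qed
qed

text \<open>The energy decreases on [0, 1) and dominates its first term, so its value at 0 is the
  bound; negative \<open>x\<close> follow by parity. The constant 3/2 is good enough because the
  squared weight multiplies it by pi/2, and 3 pi / 4 is below 3.\<close>

lemma legendreP_bernstein:
  assumes "n \<ge> 1" "\<bar>x\<bar> \<le> 1"
  shows "(2 * real n + 1) * sqrt (1 - x\<^sup>2) * (legendreP n x)\<^sup>2 \<le> 3 / 2"
proof -
  have *: "(2 * real n + 1) * sqrt (1 - x\<^sup>2) * (legendreP n x)\<^sup>2 \<le> 3 / 2" if x: "0 \<le> x" "x < 1" for x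
  proof -
    have "legendre_energy n x \<le> legendre_energy n 0"
    proof (rule DERIV_nonpos_imp_nonincreasing[OF x(1)])
      fix t assume t: "0 \<le> t" "t \<le> x"
      then have "\<bar>t\<bar> < 1" "t\<^sup>2 < 1" using x by (auto simp: abs_square_less_1)
      then show "\<exists>y. (legendre_energy n has_real_derivative y) (at t) \<and> y \<le> 0"
        using legendre_energy_derivative[of t n] t
        by (intro exI[of _ "- (8 * t * ((1 - t\<^sup>2) * legendreD n t - t * legendreP n t / 2)\<^sup>2 /
        (sqrt (1 - t\<^sup>2) * ((2 * real n + 1)\<^sup>2 * (1 - t\<^sup>2) + 1)\<^sup>2))"]) auto
    qed
    moreover have "sqrt (1 - x\<^sup>2) * (legendreP n x)\<^sup>2 \<le> legendre_energy n x"
    proof -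
      have "x\<^sup>2 \<le> 1" using x by (simp add: abs_square_le_1)
      then show ?thesis unfolding legendre_energy_def
        by (intro mult_left_mono) auto
    qed
    ultimately have "(2 * real n + 1) * (sqrt (1 - x\<^sup>2) * (legendreP n x)\<^sup>2)
        \<le> (2 * real n + 1) * legendre_energy n 0"
      by (intro mult_left_mono) auto
    also note legendre_energy_zero[OF assms(1)]
    finally show ?thesis by (simp only: mult.assoc)
  qed
  show ?thesis
  proof (cases "\<bar>x\<bar> = 1")
    case True
    then have "x\<^sup>2 = 1" by (simp add: abs_square_eq_1)
    then show ?thesis by simp
  next
    case False
    have "(legendreP n (- x))\<^sup>2 = (legendreP n x)\<^sup>2"
      unfolding legendreP_minus power_mult_distrib by (simp flip: power_mult)
    then have "(legendreP n \<bar>x\<bar>)\<^sup>2 = (legendreP n x)\<^sup>2"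
      by (cases "x \<ge> 0") auto
    then show ?thesis using *[of "\<bar>x\<bar>"] assms False by simp
  qed
qed

section \<open>The weighted uniform bound\<close>

lemma wgt_nonneg [simp]: "wgt x \<ge> 0"
  by (simp add: wgt_def)

lemma wgt_square:
  assumes "\<bar>x\<bar> \<le> 1"
  shows "(wgt x)\<^sup>2 = pi / 2 * sqrt (1 - x\<^sup>2)"
proof -
  have "1 - x\<^sup>2 \<ge> 0" using assms by (simp add: abs_square_le_1)
  then have "((1 - x\<^sup>2) powr (1/4))\<^sup>2 = sqrt (1 - x\<^sup>2)"
    by (simp add: power2_eq_square powr_half_sqrt flip: powr_add)
  then show ?thesis by (simp add: wgt_def power_mult_distrib)
qed

text \<open>The factor \<open>1 / sqrt 3\<close> of the theorem originates here; the same bound is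
  the \<open>K\<close> of the sampling theorem for orthonormal systems.\<close>

lemma wgt_legendreL_le:
  assumes "\<bar>x\<bar> \<le> 1"
  shows "\<bar>wgt x * legendreL n x\<bar> \<le> sqrt 3"
proof -
  have "(wgt x * legendreL n x)\<^sup>2 = pi / 2 * ((2 * real n + 1) * sqrt (1 - x\<^sup>2) * (legendreP n x)\<^sup>2)"
    using assms by (simp add: power_mult_distrib wgt_square legendreL_def)
  also have "\<dots> \<le> pi / 2 * (3 / 2)"
  proof (cases "n = 0")
    case True
    have "sqrt (1 - x\<^sup>2) \<le> 1" by simp
    then have "sqrt (1 - x\<^sup>2) \<le> 3 / 2" by linarith
    then show ?thesis using True by (intro mult_left_mono) auto
  next
    case False
    then show ?thesis using assms by (intro mult_left_mono legendreP_bernstein) auto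
  qed
  also have "\<dots> \<le> 3" using pi_less_4 by simp
  finally show ?thesis by (simp add: real_le_rsqrt flip: real_sqrt_abs)
qed

section \<open>Legendre polynomials as a triangular basis\<close>

lemma legendreP_polynomial:
  "\<exists>p. degree p \<le> n \<and> coeff p n > 0 \<and> poly p = legendreP n"
proof (induction n rule: less_induct)
  case (less n)
  consider "n = 0" | "n = Suc 0" | k where "n = Suc (Suc k)"
    by (metis not0_implies_Suc)
  then show ?case
  proof cases
    case 1
    then show ?thesis by (intro exI[of _ 1]) auto
  next
    case 2
    then show ?thesis by (intro exI[of _ "[:0, 1:]"]) auto
  next
    case 3
    obtain p0 where p0: "degree p0 \<le> k" "coeff p0 k > 0" "poly p0 = legendreP k"
      using less[of k] 3 by auto
    obtain p1 where p1: "degree p1 \<le> Suc k" "coeff p1 (Suc k) > 0" "poly p1 = legendreP (Suc k)"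
      using less[of "Suc k"] 3 by auto
    define p where "p = smult (1 / (real k + 2)) (smult (2 * real k + 3) (pCons 0 p1) - smult (real k + 1) p0)"
    have "coeff p0 (Suc (Suc k)) = 0" using p0(1) by (intro coeff_eq_0) simp
    then have "coeff p n > 0" using p1(2) by (simp add: p_def 3 add_pos_nonneg)
    moreover have "degree p \<le> n"
      unfolding p_def 3 using p0(1) p1(1)
      by (intro order_trans[OF degree_smult_le] degree_diff_le)
         (auto simp: degree_pCons_eq_if)
    moreover have "poly p x = legendreP n x" for x
      by (simp add: p_def 3 p0(3) p1(3) mult_ac)
    ultimately show ?thesis by blast
  qed
qed

text \<open>The positive leading coefficient is recorded because it is the pivot in
  \<open>legendre_span\<close>.\<close>

definition legendre_poly :: "nat \<Rightarrow> real poly" where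
  "legendre_poly n = (SOME p. degree p \<le> n \<and> coeff p n > 0 \<and> poly p = legendreL n)"

lemma legendre_poly: "degree (legendre_poly n) \<le> n" "coeff (legendre_poly n) n > 0"
    "poly (legendre_poly n) = legendreL n"
proof -
  obtain p where p: "degree p \<le> n" "coeff p n > 0" "poly p = legendreP n"
    using legendreP_polynomial by blast
  have "\<exists>p. degree p \<le> n \<and> coeff p n > 0 \<and> poly p = legendreL n"
    using p by (intro exI[of _ "smult (sqrt (2 * real n + 1)) p"])
      (auto simp: legendreL_def fun_eq_iff intro!: mult_pos_pos add_nonneg_pos)
  from someI_ex[OF this] show "degree (legendre_poly n) \<le> n" "coeff (legendre_poly n) n > 0"
    "poly (legendre_poly n) = legendreL n"
    unfolding legendre_poly_def by auto
qed

text \<open>Elimination of the leading coefficient. It makes every polynomial of degree at most n a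
  competitor in \<open>legendre_partial_sum_best\<close> and turns decoded polynomials into Legendre
  sums in the final theorem.\<close>

lemma legendre_span:
  assumes "degree p \<le> n"
  shows "\<exists>a. p = (\<Sum>k\<le>n. smult (a k) (legendre_poly k))"
  using assms
proof (induction n arbitrary: p)
  case 0
  define a where "a = coeff p 0 / coeff (legendre_poly 0) 0"
  have "p = smult a (legendre_poly 0)"
  proof (rule poly_eqI)
    fix i
    show "coeff p i = coeff (smult a (legendre_poly 0)) i"
      using 0 legendre_poly(1,2)[of 0] by (cases "i = 0") (auto simp: a_def coeff_eq_0)
  qed
  then show ?case by (intro exI[of _ "\<lambda>_. a"]) simp
next
  case (Suc n)
  define b where "b = coeff p (Suc n) / coeff (legendre_poly (Suc n)) (Suc n)"
  define q where "q = p - smult b (legendre_poly (Suc n))"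
  have "coeff q i = 0" if "i > n" for i
  proof (cases "i = Suc n")
    case True
    then show ?thesis using legendre_poly(2)[of "Suc n"] by (simp add: q_def b_def)
  next
    case False
    then have "i > Suc n" using that by simp
    then show ?thesis using Suc.prems legendre_poly(1)[of "Suc n"] by (simp add: q_def coeff_eq_0)
  qed
  then have "degree q \<le> n" by (intro degree_le) auto
  then obtain a where a: "q = (\<Sum>k\<le>n. smult (a k) (legendre_poly k))" using Suc.IH by blast
  have "p = (\<Sum>k\<le>n. smult (a k) (legendre_poly k)) + smult b (legendre_poly (Suc n))"
    using a by (simp add: q_def algebra_simps)
  also have "\<dots> = (\<Sum>k\<le>Suc n. smult ((a(Suc n := b)) k) (legendre_poly k))"
    by simp
  finally show ?case by blast
qed

section \<open>Fourier-Legendre series\<close>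

lemma continuous_on_legendreL [continuous_intros]: "continuous_on A (legendreL n)"
  unfolding legendreL_def by (intro continuous_intros)

lemma continuous_on_wgt [continuous_intros]: "continuous_on {-1..1} wgt"
proof -
  have "1 - x\<^sup>2 \<ge> 0" if "x \<in> {-1..1}" for x :: real
    using that by (auto simp: abs_square_le_1)
  then show ?thesis unfolding wgt_def
    by (intro continuous_intros continuous_on_powr') auto
qed

lemma flcoeff_diff:
  assumes "continuous_on {-1..1} f" "continuous_on {-1..1} g"
  shows "flcoeff (\<lambda>x. f x - g x) k = flcoeff f k - flcoeff g k"
proof -
  have "integral {-1..1} (\<lambda>x. f x * legendreL k x - g x * legendreL k x) =
     integral {-1..1} (\<lambda>x. f x * legendreL k x) - integral {-1..1} (\<lambda>x. g x * legendreL k x)"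
    using assms by (intro integral_diff integrable_continuous_real continuous_intros)
  then show ?thesis by (simp add: flcoeff_def left_diff_distrib right_diff_distrib)
qed

section \<open>Partial sums, completeness and absolutely convergent series\<close>

definition legendre_sum :: "(nat \<Rightarrow> real) \<Rightarrow> nat \<Rightarrow> real poly" where
  "legendre_sum c n = (\<Sum>k\<le>n. smult (c k) (legendre_poly k))"

lemma poly_legendre_sum: "poly (legendre_sum c n) x = (\<Sum>k\<le>n. c k * legendreL k x)"
  by (simp add: legendre_sum_def poly_sum legendre_poly(3))

lemma degree_legendre_sum: "degree (legendre_sum c n) \<le> n"
  unfolding legendre_sum_def
  by (intro degree_sum_le order_trans[OF degree_smult_le] order_trans[OF legendre_poly(1)]) auto

lemma flcoeff_legendre_sum:
  "flcoeff (poly (legendre_sum c n)) j = (if j \<le> n then c j else 0)"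
proof -
  have "integral {-1..1} (\<lambda>x. poly (legendre_sum c n) x * legendreL j x) =
      integral {-1..1} (\<lambda>x. \<Sum>k\<le>n. c k * (legendreL k x * legendreL j x))"
    by (simp add: poly_legendre_sum sum_distrib_right mult.assoc)
  also have "\<dots> = (\<Sum>k\<le>n. c k * integral {-1..1} (\<lambda>x. legendreL k x * legendreL j x))"
    by (subst integral_sum) (auto intro!: integrable_continuous_real continuous_intros)
  also have "\<dots> = (\<Sum>k\<le>n. if k = j then 2 * c k else 0)"
    by (intro sum.cong) (auto simp: legendreL_integral)
  finally show ?thesis by (simp add: flcoeff_def)
qed

text \<open>By Pythagoras, since \<open>f - S\<close> is orthogonal to \<open>h = S - p\<close>.
  This carries Weierstrass approximation, which yields some polynomial, over to the Legendre partial
  sums.\<close>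

lemma legendre_partial_sum_best:
  assumes f: "continuous_on {-1..1} f" and p: "degree p \<le> n"
  shows "integral {-1..1} (\<lambda>x. (f x - poly (legendre_sum (flcoeff f) n) x)\<^sup>2)
     \<le> integral {-1..1} (\<lambda>x. (f x - poly p x)\<^sup>2)"
proof -
  define S where "S = poly (legendre_sum (flcoeff f) n)"
  have S: "continuous_on {-1..1} S" unfolding S_def by (intro continuous_intros)
  obtain a where a: "p = legendre_sum a n" using legendre_span[OF p] unfolding legendre_sum_def by blast
  define h where "h x = S x - poly p x" for x
  have h: "h x = (\<Sum>k\<le>n. (flcoeff f k - a k) * legendreL k x)" for x
    unfolding h_def S_def a poly_legendre_sum by (simp add: sum_subtractf left_diff_distrib)
  have hc: "continuous_on {-1..1} h" unfolding h_def by (intro continuous_intros S)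
  have "integral {-1..1} (\<lambda>x. (f x - S x) * h x) =
     integral {-1..1} (\<lambda>x. \<Sum>k\<le>n. (flcoeff f k - a k) * ((f x - S x) * legendreL k x))"
    unfolding h by (simp add: sum_distrib_left mult_ac)
  also have "\<dots> = (\<Sum>k\<le>n. (flcoeff f k - a k) * integral {-1..1} (\<lambda>x. (f x - S x) * legendreL k x))"
    using f S by (subst integral_sum) (auto intro!: integrable_continuous_real continuous_intros)
  also have "\<dots> = (\<Sum>k\<le>n. (flcoeff f k - a k) * (2 * flcoeff (\<lambda>x. f x - S x) k))"
    by (simp add: flcoeff_def)
  also have "\<dots> = 0"
    using f S by (intro sum.neutral) (auto simp: flcoeff_diff, simp add: S_def flcoeff_legendre_sum)
  finally have orth: "integral {-1..1} (\<lambda>x. (f x - S x) * h x) = 0" .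
  have "integral {-1..1} (\<lambda>x. (f x - poly p x)\<^sup>2) =
     integral {-1..1} (\<lambda>x. ((f x - S x)\<^sup>2 + (h x)\<^sup>2) + 2 * ((f x - S x) * h x))"
    by (intro integral_cong) (simp add: h_def power2_eq_square algebra_simps)
  also have "\<dots> = integral {-1..1} (\<lambda>x. (f x - S x)\<^sup>2 + (h x)\<^sup>2)"
    using f S hc orth by (subst integral_add) (auto intro!: integrable_continuous_real continuous_intros)
  also have "\<dots> \<ge> integral {-1..1} (\<lambda>x. (f x - S x)\<^sup>2)"
    using f S hc by (intro integral_le integrable_continuous_real continuous_intros) auto
  finally show ?thesis by (simp add: S_def)
qed

lemma legendre_partial_sum_L2:
  assumes f: "continuous_on {-1..1} f" and e: "e > 0"
  shows "\<exists>d. \<forall>n\<ge>d. integral {-1..1} (\<lambda>x. (f x - poly (legendre_sum (flcoeff f) n) x)\<^sup>2) \<le> e"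
proof -
  \<comment> \<open>The interval has length 2, so a uniform error \<open>\<delta>\<close>
    contributes \<open>2 * \<delta>\<^sup>2 = e\<close>.\<close>
  define \<delta> where "\<delta> = sqrt (e / 2)"
  have \<delta>: "\<delta> > 0" "\<delta>\<^sup>2 = e / 2" using e by (auto simp: \<delta>_def)
  obtain g where g: "real_polynomial_function g" "\<And>x. x \<in> {-1..1} \<Longrightarrow> \<bar>f x - g x\<bar> < \<delta>"
    using Stone_Weierstrass_real_polynomial_function[OF _ f \<delta>(1)] by auto
  obtain a d where ad: "g = (\<lambda>x. \<Sum>i\<le>d. a i * x ^ i)"
    using g(1) real_polynomial_function_iff_sum by blast
  define p where "p = (\<Sum>i\<le>d. monom (a i) i)"
  have pg: "poly p = g" by (auto simp: p_def ad poly_sum poly_monom)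
  have deg: "degree p \<le> d"
    unfolding p_def by (intro degree_sum_le order_trans[OF degree_monom_le]) auto
  have "integral {-1..1} (\<lambda>x. (f x - poly (legendre_sum (flcoeff f) n) x)\<^sup>2) \<le> e" if "n \<ge> d" for n
  proof -
    have "integral {-1..1} (\<lambda>x. (f x - poly (legendre_sum (flcoeff f) n) x)\<^sup>2)
      \<le> integral {-1..1} (\<lambda>x. (f x - poly p x)\<^sup>2)"
      using deg that by (intro legendre_partial_sum_best f) auto
    also have "\<dots> \<le> integral {-1..1} (\<lambda>x::real. \<delta>\<^sup>2)"
    proof (intro integral_le integrable_continuous_real continuous_intros f)
      fix x :: real assume "x \<in> {-1..1}"
      then have "\<bar>f x - poly p x\<bar> \<le> \<bar>\<delta>\<bar>" using g(2)[of x] \<delta>(1) by (simp add: pg)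
      then show "(f x - poly p x)\<^sup>2 \<le> \<delta>\<^sup>2" by (simp only: abs_le_square_iff)
    qed
    also have "\<dots> = e" using \<delta> by simp
    finally show ?thesis .
  qed
  then show ?thesis by blast
qed

lemma wgt_square_le: "\<bar>x\<bar> \<le> 1 \<Longrightarrow> (wgt x)\<^sup>2 \<le> 2"
proof -
  assume x: "\<bar>x\<bar> \<le> 1"
  have "pi / 2 * sqrt (1 - x\<^sup>2) \<le> 2 * 1" using pi_less_4 x by (intro mult_mono) (auto simp: abs_square_le_1)
  then show ?thesis using x by (simp add: wgt_square)
qed

text \<open>Summable coefficients give no uniform majorant for the series itself, since
  \<open>L_k(1) = sqrt (2k + 1)\<close>; multiplied by the weight it passes the M-test. Its limit
  \<open>H\<close> is continuous and agrees with \<open>w f\<close> in mean square by completeness,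
  hence everywhere.\<close>

lemma wgt_mult_le_coeff_sum:
  assumes f: "continuous_on {-1..1} f" and sm: "summable (\<lambda>k. \<bar>flcoeff f k\<bar>)" and x: "x \<in> {-1..1}"
  shows "\<bar>f x\<bar> * wgt x \<le> sqrt 3 * (\<Sum>k. \<bar>flcoeff f k\<bar>)"
proof -
  define g where "g k x = flcoeff f k * (wgt x * legendreL k x)" for k x
  define H where "H x = (\<Sum>k. g k x)" for x
  define S where "S n = poly (legendre_sum (flcoeff f) n)" for n
  have gb: "norm (g k x) \<le> sqrt 3 * \<bar>flcoeff f k\<bar>" if "x \<in> {-1..1}" for k x
  proof -
    have "\<bar>flcoeff f k\<bar> * \<bar>wgt x * legendreL k x\<bar> \<le> \<bar>flcoeff f k\<bar> * sqrt 3"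
      using that by (intro mult_left_mono wgt_legendreL_le) auto
    then show ?thesis by (simp add: g_def abs_mult mult.commute)
  qed
  have sm3: "summable (\<lambda>k. sqrt 3 * \<bar>flcoeff f k\<bar>)" using sm by (rule summable_mult)
  have ul: "uniform_limit {-1..1} (\<lambda>n x. \<Sum>k<n. g k x) H sequentially"
    unfolding H_def by (rule Weierstrass_m_test[OF gb sm3])
  have gc: "continuous_on {-1..1} (g k)" for k unfolding g_def by (intro continuous_intros)
  have Hc: "continuous_on {-1..1} H"
    by (rule uniform_limit_theorem[OF _ ul]) (auto intro!: always_eventually continuous_intros gc)
  have gS: "(\<Sum>k<Suc n. g k x) = wgt x * S n x" for n x
    unfolding g_def S_def poly_legendre_sum lessThan_Suc_atMost by (simp add: sum_distrib_left mult_ac)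
  define D where "D x = f x * wgt x - H x" for x
  have Dc: "continuous_on {-1..1} (\<lambda>x. (D x)\<^sup>2)" unfolding D_def by (intro continuous_intros f Hc)
  have Sc: "continuous_on {-1..1} (S n)" for n unfolding S_def by (intro continuous_intros)
  have "integral {-1..1} (\<lambda>x. (D x)\<^sup>2) \<le> e" if e: "e > 0" for e
  proof -
    \<comment> \<open>As \<open>w\<^sup>2 \<le> 2\<close>, the square of \<open>D\<close> is at most
      \<open>4 (f - S n)\<^sup>2 + 2 \<delta>\<^sup>2\<close>; over an interval of length 2 each
      part contributes at most \<open>e / 2\<close>.\<close>
    define \<delta> where "\<delta> = sqrt (e / 8)"
    have \<delta>: "\<delta> > 0" "\<delta>\<^sup>2 = e / 8" using e by (auto simp: \<delta>_def)
    obtain d where d: "\<forall>n\<ge>d. integral {-1..1} (\<lambda>x. (f x - S n x)\<^sup>2) \<le> e / 8"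
      using legendre_partial_sum_L2[OF f, of "e / 8"] e unfolding S_def by auto
    obtain d' where d': "\<forall>n\<ge>d'. \<forall>x\<in>{-1..1}. dist (\<Sum>k<n. g k x) (H x) < \<delta>"
      using uniform_limitD[OF ul \<delta>(1)] unfolding eventually_sequentially by blast
    define n where "n = max d d'"
    have "(D x)\<^sup>2 \<le> 4 * (f x - S n x)\<^sup>2 + 2 * \<delta>\<^sup>2" if x: "x \<in> {-1..1}" for x
    proof -
      have "\<bar>wgt x * S n x - H x\<bar> \<le> \<bar>\<delta>\<bar>"
      proof -
        have "d' \<le> Suc n" by (simp add: n_def)
        then show ?thesis using d'[rule_format, of "Suc n" x] x \<delta>(1) unfolding gS dist_real_def by auto
      qed
      then have 1: "(wgt x * S n x - H x)\<^sup>2 \<le> \<delta>\<^sup>2" by (simp only: abs_le_square_iff)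
      have 2: "(wgt x)\<^sup>2 * (f x - S n x)\<^sup>2 \<le> 2 * (f x - S n x)\<^sup>2"
        using x by (intro mult_right_mono wgt_square_le) auto
      have "D x = wgt x * (f x - S n x) + (wgt x * S n x - H x)" by (simp add: D_def algebra_simps)
      moreover have "(u + v)\<^sup>2 \<le> 2 * u\<^sup>2 + 2 * v\<^sup>2" for u v :: real
        using zero_le_power2[of "u - v"] by (simp add: power2_eq_square algebra_simps)
      ultimately have "(D x)\<^sup>2 \<le> 2 * (wgt x * (f x - S n x))\<^sup>2 + 2 * (wgt x * S n x - H x)\<^sup>2" by simp
      then show ?thesis using 1 2 by (simp add: power_mult_distrib)
    qed
    then have "integral {-1..1} (\<lambda>x. (D x)\<^sup>2) \<le> integral {-1..1} (\<lambda>x. 4 * (f x - S n x)\<^sup>2 + 2 * \<delta>\<^sup>2)"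
      by (intro integral_le integrable_continuous_real continuous_intros f Sc Dc) auto
    also have "\<dots> = 4 * integral {-1..1} (\<lambda>x. (f x - S n x)\<^sup>2) + integral {-1..1} (\<lambda>x::real. 2 * \<delta>\<^sup>2)"
      by (subst integral_add) (auto intro!: integrable_continuous_real continuous_intros f Sc)
    also have "\<dots> \<le> 4 * (e / 8) + 4 * (e / 8)"
      using d by (intro add_mono mult_left_mono) (auto simp: n_def \<delta>)
    finally show ?thesis by simp
  qed
  then have "integral {-1..1} (\<lambda>x. (D x)\<^sup>2) \<le> 0" by (rule field_le_epsilon[of _ 0, simplified])
  moreover have "integral {-1..1} (\<lambda>x. (D x)\<^sup>2) \<ge> 0"
    by (intro integral_nonneg integrable_continuous_real Dc) auto
  ultimately have "integral {-1..1} (\<lambda>x. (D x)\<^sup>2) = 0" by linarith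
  then have "(D x)\<^sup>2 = 0" using integral_eq_0_iff[OF Dc] x by auto
  then have "f x * wgt x = H x" by (simp add: D_def)
  then have "\<bar>f x\<bar> * wgt x = \<bar>H x\<bar>" by (metis abs_mult abs_of_nonneg wgt_nonneg)
  also have "\<dots> \<le> (\<Sum>k. sqrt 3 * \<bar>flcoeff f k\<bar>)"
    unfolding H_def using norm_suminf_le[OF gb[OF x] sm3] by simp
  also have "\<dots> = sqrt 3 * (\<Sum>k. \<bar>flcoeff f k\<bar>)" using sm by (rule suminf_mult)
  finally show ?thesis .
qed

lemma A_norm_1: "A_norm 1 f = (\<Sum>k. \<bar>flcoeff f k\<bar>)" if "summable (\<lambda>k. \<bar>flcoeff f k\<bar>)"
  using suminf_nonneg[OF that] by (simp add: A_norm_def)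

lemma wsup_norm_le_A_norm:
  assumes "continuous_on {-1..1} f" "summable (\<lambda>k. \<bar>flcoeff f k\<bar>)"
  shows "1 / sqrt 3 * wsup_norm f \<le> A_norm 1 f"
proof -
  have "wsup_norm f \<le> sqrt 3 * A_norm 1 f"
    unfolding wsup_norm_def A_norm_1[OF assms(2)]
    by (rule cSUP_least) (auto intro!: wgt_mult_le_coeff_sum assms)
  then show ?thesis by (simp add: field_simps)
qed

section \<open>Sampling bounded orthonormal systems\<close>

text \<open>The points are chosen one after the other so that the weighted sum of the exponential moments
  does not increase; each factor has mean at most 1.\<close>

lemma (in prob_space) exists_points_hitting:
  fixes A :: "'i \<Rightarrow> 'a set" and p :: "'i \<Rightarrow> real" and m :: nat
  assumes "finite I"
    and A: "\<And>i. i \<in> I \<Longrightarrow> A i \<in> sets M" and p: "\<And>i. i \<in> I \<Longrightarrow> p i \<le> prob (A i)"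
    and small: "(\<Sum>i\<in>I. exp (- p i * real m / 10)) < 1"
  shows "\<exists>x. (\<forall>j<m. x j \<in> space M) \<and>
           (\<forall>i\<in>I. p i * real m / 2 \<le> (\<Sum>j<m. indicat_real (A i) (x j)))"
proof -
  \<comment> \<open>Each factor has mean at most 1 because \<open>1 - exp (-1) \<ge> 3/5\<close>. As
    3/5 - 1/10 = 1/2, the weight \<open>v i\<close> times all \<open>m\<close> factors is
    \<open>exp (p i * m / 2 - hits)\<close>, and a total below 1 forces at least
    \<open>p i * m / 2\<close> hits. The successive choice avoids a product measure.\<close>
  define g where "g i x = exp (3/5 * p i - indicat_real (A i) x)" for i x
  define v where "v i = exp (- p i * real m / 10)" for i
  have g_alt: "g i x = exp (3/5 * p i) * (1 - (1 - exp (-1)) * indicat_real (A i) x)" for i x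
    by (cases "x \<in> A i") (simp_all add: g_def flip: exp_add)
  have e: "1 - exp (-1) \<ge> (3/5::real)"
  proof -
    have "exp (1::real) \<ge> 5/2" using exp_lower_Taylor_quadratic[of 1] by simp
    then have "inverse (exp (1::real)) \<le> inverse (5/2)" by (intro le_imp_inverse_le) auto
    then show ?thesis by (simp add: exp_minus)
  qed
  have int_g: "integrable M (g i)" if "i \<in> I" for i
    unfolding g_alt using A[OF that] by (intro integrable_mult_right Bochner_Integration.integrable_diff) (auto simp: emeasure_eq_measure)
  have mean_g: "(\<integral>x. g i x \<partial>M) \<le> 1" if "i \<in> I" for i
  proof -
    have "(\<integral>x. g i x \<partial>M) = exp (3/5 * p i) * (1 - (1 - exp (-1)) * prob (A i))"
      unfolding g_alt using A[OF that]
      by (subst integral_mult_right_zero) (simp add: emeasure_eq_measure prob_space)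
    also have "\<dots> \<le> exp (3/5 * p i) * exp (- (3/5 * p i))"
    proof (intro mult_left_mono)
      have "1 - (1 - exp (-1)) * prob (A i) \<le> 1 + - (3/5 * prob (A i))"
        using mult_right_mono[OF e, of "prob (A i)"] by simp
      also have "\<dots> \<le> exp (- (3/5 * prob (A i)))" by (rule exp_ge_add_one_self)
      also have "\<dots> \<le> exp (- (3/5 * p i))" using p[OF that] by simp
      finally show "1 - (1 - exp (-1)) * prob (A i) \<le> exp (- (3/5 * p i))" .
    qed simp
    finally show ?thesis by (simp flip: exp_add)
  qed
  have "\<exists>x. (\<forall>j<k. x j \<in> space M) \<and> (\<Sum>i\<in>I. v i * (\<Prod>j<k. g i (x j))) \<le> (\<Sum>i\<in>I. v i)" for k :: nat
  proof (induction k)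
    case 0
    then show ?case by simp
  next
    case (Suc k)
    then obtain x where x: "\<forall>j<k. x j \<in> space M" 
      and le: "(\<Sum>i\<in>I. v i * (\<Prod>j<k. g i (x j))) \<le> (\<Sum>i\<in>I. v i)" by blast
    define c where "c i = v i * (\<Prod>j<k. g i (x j))" for i
    have c: "c i \<ge> 0" for i by (auto simp: c_def v_def g_def intro!: mult_nonneg_nonneg prod_nonneg)
    have "(\<integral>y. (\<Sum>i\<in>I. c i * g i y) \<partial>M) = (\<Sum>i\<in>I. c i * (\<integral>y. g i y \<partial>M))"
      by (subst Bochner_Integration.integral_sum) (auto intro!: int_g)
    also have "\<dots> \<le> (\<Sum>i\<in>I. c i)"
      by (intro sum_mono mult_left_le c mean_g)
    finally have I: "(\<integral>y. (\<Sum>i\<in>I. c i * g i y) \<partial>M) \<le> sum c I" .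
    have "\<exists>y\<in>space M. (\<Sum>i\<in>I. c i * g i y) \<le> sum c I"
    proof (rule ccontr)
      assume "\<not> ?thesis"
      then have "AE y in M. sum c I < (\<Sum>i\<in>I. c i * g i y)" by (intro AE_I2) auto
      then have "sum c I < (\<integral>y. (\<Sum>i\<in>I. c i * g i y) \<partial>M)"
        by (intro expectation_greater) (auto intro!: Bochner_Integration.integrable_sum int_g)
      with I show False by simp
    qed
    then obtain y where y: "y \<in> space M" "(\<Sum>i\<in>I. c i * g i y) \<le> sum c I" by blast
    have "(\<Sum>i\<in>I. v i * (\<Prod>j<Suc k. g i ((x(k := y)) j))) = (\<Sum>i\<in>I. c i * g i y)"
      by (intro sum.cong) (auto simp: c_def intro!: prod.cong)
    then show ?case using y x le unfolding c_def
      by (intro exI[of _ "x(k := y)"]) (auto simp: less_Suc_eq)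
  qed
  from this[of m] obtain x where x: "\<forall>j<m. x j \<in> space M"
    and le: "(\<Sum>i\<in>I. v i * (\<Prod>j<m. g i (x j))) \<le> (\<Sum>i\<in>I. v i)" by blast
  have "p i * real m / 2 \<le> (\<Sum>j<m. indicat_real (A i) (x j))" if i: "i \<in> I" for i
  proof -
    have "v i * (\<Prod>j<m. g i (x j)) = exp (- p i * real m / 10 + (\<Sum>j<m. 3/5 * p i - indicat_real (A i) (x j)))"
      unfolding v_def g_def exp_add by (simp only: exp_sum finite_lessThan)
    also have "- p i * real m / 10 + (\<Sum>j<m. 3/5 * p i - indicat_real (A i) (x j))
       = p i * real m / 2 - (\<Sum>j<m. indicat_real (A i) (x j))"
      by (simp add: sum_subtractf)
    finally have eq: "v i * (\<Prod>j<m. g i (x j)) = exp (p i * real m / 2 - (\<Sum>j<m. indicat_real (A i) (x j)))" .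
    have "v i * (\<Prod>j<m. g i (x j)) \<le> (\<Sum>i\<in>I. v i * (\<Prod>j<m. g i (x j)))"
      by (rule member_le_sum[OF i]) (auto simp: v_def g_def assms(1) intro!: mult_nonneg_nonneg prod_nonneg)
    also have "\<dots> < 1" using le small by (simp add: v_def)
    finally show ?thesis unfolding eq by simp
  qed
  with x show ?thesis by blast
qed

section \<open>Maurey's empirical method\<close>

lemma exp_le_add_exp_square: "exp y \<le> y + exp (y\<^sup>2)" for y :: real
proof -
  have q: "1 + y\<^sup>2 \<le> exp (y\<^sup>2)" by (rule exp_ge_add_one_self)
  consider "y > 1" | "0 \<le> y" "y \<le> 1" | "y < 0" by linarith
  then show ?thesis
  proof cases
    case 1
    then have "y \<le> y\<^sup>2" by (simp add: power2_eq_square)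
    then have "exp y \<le> exp (y\<^sup>2)" by simp
    then show ?thesis using 1 by linarith
  next
    case 2
    then show ?thesis using exp_bound[of y] q by linarith
  next
    case 3
    have "exp (- y) \<ge> 1 - y" using exp_ge_add_one_self[of "- y"] by simp
    then have "inverse (exp (- y)) \<le> inverse (1 - y)" using 3 by (intro le_imp_inverse_le) auto
    also have "inverse (1 - y) \<le> 1 + y + y\<^sup>2"
    proof -
      have "(1 + y + y\<^sup>2) * (1 - y) = 1 - y ^ 3" by algebra
      moreover have "y ^ 3 \<le> 0" using 3 by (simp add: power_le_zero_eq)
      ultimately show ?thesis using 3 by (simp add: inverse_eq_divide pos_divide_le_eq)
    qed
    finally have "exp y \<le> 1 + y + y\<^sup>2" by (simp add: exp_minus)
    then show ?thesis using q by linarith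
  qed
qed

lemma (in prob_space) integrable_exp_bounded:
  fixes f :: "'a \<Rightarrow> real"
  assumes "f \<in> borel_measurable M" "\<And>y. y \<in> space M \<Longrightarrow> \<bar>f y\<bar> \<le> B"
  shows "integrable M (\<lambda>y. exp (a * f y))"
proof (rule integrable_const_bound[of _ "exp (\<bar>a\<bar> * B)"])
  show "AE y in M. norm (exp (a * f y)) \<le> exp (\<bar>a\<bar> * B)"
  proof (rule AE_I2)
    fix y assume "y \<in> space M"
    then have "\<bar>a * f y\<bar> \<le> \<bar>a\<bar> * B" using assms(2) by (simp add: abs_mult mult_left_mono)
    then show "norm (exp (a * f y)) \<le> exp (\<bar>a\<bar> * B)" by simp
  qed
  show "(\<lambda>y. exp (a * f y)) \<in> borel_measurable M" using assms(1) by measurable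
qed

lemma convex_sum_abs_le:
  fixes p z :: "'i \<Rightarrow> real"
  assumes "\<And>i. i \<in> I \<Longrightarrow> p i \<ge> 0" "sum p I = 1" "\<And>i. i \<in> I \<Longrightarrow> \<bar>z i\<bar> \<le> b"
  shows "\<bar>\<Sum>i\<in>I. p i * z i\<bar> \<le> b"
proof -
  have "\<bar>\<Sum>i\<in>I. p i * z i\<bar> \<le> (\<Sum>i\<in>I. \<bar>p i * z i\<bar>)" by (rule sum_abs)
  also have "\<dots> \<le> (\<Sum>i\<in>I. p i * b)"
    using assms by (intro sum_mono) (auto simp: abs_mult intro!: mult_left_mono)
  also have "\<dots> = b" using assms(2) by (simp flip: sum_distrib_right)
  finally show ?thesis .
qed

lemma sum_list_abs_le:
  fixes z :: "'i \<Rightarrow> real"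
  assumes "\<And>i. i \<in> set ks \<Longrightarrow> \<bar>z i\<bar> \<le> b"
  shows "\<bar>\<Sum>i\<leftarrow>ks. z i\<bar> \<le> real (length ks) * b"
  using assms
proof (induction ks)
  case (Cons i ks)
  have "\<bar>z i\<bar> \<le> b" "\<bar>\<Sum>i\<leftarrow>ks. z i\<bar> \<le> real (length ks) * b" using Cons by auto
  then show ?case by (simp add: algebra_simps)
qed simp

lemma borel_measurable_sum_list:
  fixes \<psi> :: "'i \<Rightarrow> 'a \<Rightarrow> real"
  assumes "\<And>i. i \<in> set ks \<Longrightarrow> \<psi> i \<in> borel_measurable M"
  shows "(\<lambda>y. \<Sum>i\<leftarrow>ks. \<psi> i y) \<in> borel_measurable M"
  using assms by (induction ks) auto

text \<open>A Hoeffding bound with simple constants: the linear term in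
  \<open>exp_le_add_exp_square\<close> averages to 0 after centring, and the centred values are at
  most \<open>2 * b\<close>, whose square gives the factor 4.\<close>

lemma weighted_exp_moment:
  fixes p z :: "'i \<Rightarrow> real"
  assumes "finite I" "\<And>i. i \<in> I \<Longrightarrow> p i \<ge> 0" "sum p I = 1" "\<And>i. i \<in> I \<Longrightarrow> \<bar>z i\<bar> \<le> b"
  shows "(\<Sum>i\<in>I. p i * exp (l * (z i - (\<Sum>i\<in>I. p i * z i)))) \<le> exp (4 * l\<^sup>2 * b\<^sup>2)"
proof -
  define \<mu> where "\<mu> = (\<Sum>i\<in>I. p i * z i)"
  have mu: "\<bar>\<mu>\<bar> \<le> b"
    unfolding \<mu>_def using assms by (intro convex_sum_abs_le) auto
  have "p i * exp (l * (z i - \<mu>)) \<le> p i * (l * (z i - \<mu>) + exp (4 * l\<^sup>2 * b\<^sup>2))" if i: "i \<in> I" for i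
  proof -
    have "\<bar>z i - \<mu>\<bar> \<le> 2 * b" using mu assms(4)[OF i] by linarith
    then have "(z i - \<mu>)\<^sup>2 \<le> (2 * b)\<^sup>2" by (intro abs_le_square_iff[THEN iffD1]) linarith
    then have "(l * (z i - \<mu>))\<^sup>2 \<le> l\<^sup>2 * (2 * b)\<^sup>2"
      unfolding power_mult_distrib by (intro mult_left_mono) auto
    then have "exp ((l * (z i - \<mu>))\<^sup>2) \<le> exp (4 * l\<^sup>2 * b\<^sup>2)" by (simp add: power_mult_distrib)
    with exp_le_add_exp_square[of "l * (z i - \<mu>)"]
    have "exp (l * (z i - \<mu>)) \<le> l * (z i - \<mu>) + exp (4 * l\<^sup>2 * b\<^sup>2)" by linarith
    then show ?thesis using assms(2)[OF i] by (intro mult_left_mono)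
  qed
  then have "(\<Sum>i\<in>I. p i * exp (l * (z i - \<mu>))) \<le> (\<Sum>i\<in>I. p i * (l * (z i - \<mu>) + exp (4 * l\<^sup>2 * b\<^sup>2)))"
    by (rule sum_mono)
  also have "\<dots> = l * (\<Sum>i\<in>I. p i * z i) - l * \<mu> * sum p I + exp (4 * l\<^sup>2 * b\<^sup>2) * sum p I"
    by (simp add: algebra_simps sum.distrib sum_subtractf sum_distrib_left sum_distrib_right)
  also have "\<dots> = exp (4 * l\<^sup>2 * b\<^sup>2)" using assms(3) by (simp add: \<mu>_def)
  finally show ?thesis by (simp add: \<mu>_def)
qed

text \<open>Maurey's empirical method, run simultaneously for the measure \<open>M\<close> and for the empirical measure
  of the points \<open>x\<close>.\<close>

lemma (in prob_space) maurey_exp: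
  fixes \<psi> :: "'i \<Rightarrow> 'a \<Rightarrow> real" and p :: "'i \<Rightarrow> real" and x :: "nat \<Rightarrow> 'a"
  assumes fin: "finite I" and p: "\<And>i. i \<in> I \<Longrightarrow> p i \<ge> 0" "sum p I = 1"
    and \<psi>: "\<And>i. i \<in> I \<Longrightarrow> \<psi> i \<in> borel_measurable M"
    and b: "\<And>i y. i \<in> I \<Longrightarrow> y \<in> space M \<Longrightarrow> \<bar>\<psi> i y\<bar> \<le> b"
    and x: "\<And>j. j < m \<Longrightarrow> x j \<in> space M"
    and F: "F = (\<lambda>y. \<Sum>i\<in>I. p i * \<psi> i y)"
    and J: "J = (\<lambda>g. (\<integral>y. g y \<partial>M) + (\<Sum>j<m. g (x j)) / real m)"
  shows "\<exists>ks. length ks = k \<and> set ks \<subseteq> I \<and>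
     J (\<lambda>y. exp (l * ((\<Sum>i\<leftarrow>ks. \<psi> i y) - real k * F y)) + exp (- l * ((\<Sum>i\<leftarrow>ks. \<psi> i y) - real k * F y)))
       \<le> 4 * exp (4 * l\<^sup>2 * b\<^sup>2) ^ k"
proof (induction k)
  case 0
  \<comment> \<open>For the empty list the integrand is the constant 2, so each half of
    \<open>J\<close> is at most 2, whence the factor 4. For \<open>m = 0\<close> the empirical half
    is 0, division by zero being 0.\<close>
  have "(\<Sum>j<m. 2) / real m \<le> (2::real)" by (cases "m = 0") auto
  then show ?case by (simp add: J prob_space)
next
  case (Suc k)
  define E where "E = exp (4 * l\<^sup>2 * b\<^sup>2)"
  from Suc obtain ks where ks: "length ks = k" "set ks \<subseteq> I"
    and le: "J (\<lambda>y. exp (l * ((\<Sum>i\<leftarrow>ks. \<psi> i y) - real k * F y)) + exp (- l * ((\<Sum>i\<leftarrow>ks. \<psi> i y) - real k * F y)))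
       \<le> 4 * E ^ k" unfolding E_def by blast
  define S where "S y = (\<Sum>i\<leftarrow>ks. \<psi> i y) - real k * F y" for y
  define h where "h i y = exp (l * (S y + (\<psi> i y - F y))) + exp (- l * (S y + (\<psi> i y - F y)))" for i y
  have Fm: "F \<in> borel_measurable M" unfolding F using \<psi> by measurable
  have lm: "(\<lambda>y. \<Sum>i\<leftarrow>ks. \<psi> i y) \<in> borel_measurable M"
    using ks(2) by (intro borel_measurable_sum_list \<psi>) auto
  have Sm: "S \<in> borel_measurable M" unfolding S_def using lm Fm by measurable
  have Fb: "\<bar>F y\<bar> \<le> b" if "y \<in> space M" for y
    unfolding F using p b[OF _ that] by (intro convex_sum_abs_le)
  have Sb: "\<bar>S y\<bar> \<le> real k * b + real k * b" if y: "y \<in> space M" for y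
  proof -
    have "\<bar>\<Sum>i\<leftarrow>ks. \<psi> i y\<bar> \<le> real (length ks) * b"
      using ks(2) b[OF _ y] by (intro sum_list_abs_le) auto
    moreover have "\<bar>real k * F y\<bar> \<le> real k * b"
      using Fb[OF y] by (simp add: abs_mult mult_left_mono)
    ultimately show ?thesis unfolding S_def ks(1) by linarith
  qed
  have int_h: "integrable M (h i)" if i: "i \<in> I" for i
    unfolding h_def
  proof (intro Bochner_Integration.integrable_add integrable_exp_bounded)
    show "(\<lambda>y. S y + (\<psi> i y - F y)) \<in> borel_measurable M" using Sm Fm \<psi>[OF i] by measurable
    show "\<bar>S y + (\<psi> i y - F y)\<bar> \<le> real k * b + real k * b + 2 * b" if "y \<in> space M" for y
      using Sb[OF that] Fb[OF that] b[OF i that] by linarith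
    show "(\<lambda>y. S y + (\<psi> i y - F y)) \<in> borel_measurable M" using Sm Fm \<psi>[OF i] by measurable
    show "\<bar>S y + (\<psi> i y - F y)\<bar> \<le> real k * b + real k * b + 2 * b" if "y \<in> space M" for y
      using Sb[OF that] Fb[OF that] b[OF i that] by linarith
  qed
  have avg: "(\<Sum>i\<in>I. p i * h i y) \<le> E * (exp (l * S y) + exp (- l * S y))" if y: "y \<in> space M" for y
  proof -
    have "(\<Sum>i\<in>I. p i * h i y) = exp (l * S y) * (\<Sum>i\<in>I. p i * exp (l * (\<psi> i y - F y))) +
        exp (- l * S y) * (\<Sum>i\<in>I. p i * exp (- l * (\<psi> i y - F y)))"
    proof -
      have "p i * h i y = exp (l * S y) * (p i * exp (l * (\<psi> i y - F y))) +
        exp (- l * S y) * (p i * exp (- l * (\<psi> i y - F y)))" for i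
        unfolding h_def distrib_left[of l] distrib_left[of "- l"] exp_add by algebra
      then show ?thesis by (simp only: sum.distrib sum_distrib_left)
    qed
    also have "\<dots> \<le> exp (l * S y) * E + exp (- l * S y) * E"
      using weighted_exp_moment[of I p "\<lambda>i. \<psi> i y" b l] weighted_exp_moment[of I p "\<lambda>i. \<psi> i y" b "- l"]
        fin p b[OF _ y] unfolding F E_def
      by (intro add_mono mult_left_mono) auto
    finally show ?thesis by (simp add: algebra_simps)
  qed
  have "(\<Sum>i\<in>I. p i * J (h i)) = J (\<lambda>y. \<Sum>i\<in>I. p i * h i y)"
  proof -
    have 1: "(\<integral>y. (\<Sum>i\<in>I. p i * h i y) \<partial>M) = (\<Sum>i\<in>I. p i * (\<integral>y. h i y \<partial>M))"
      by (subst Bochner_Integration.integral_sum) (auto intro!: int_h)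
    have 2: "(\<Sum>j<m. \<Sum>i\<in>I. p i * h i (x j)) = (\<Sum>i\<in>I. p i * (\<Sum>j<m. h i (x j)))"
      by (subst sum.swap) (simp add: sum_distrib_left)
    show ?thesis unfolding J 1 2 by (simp add: distrib_left sum.distrib sum_divide_distrib sum_distrib_left)
  qed
  also have "\<dots> \<le> J (\<lambda>y. E * (exp (l * S y) + exp (- l * S y)))"
    unfolding J
  proof (intro add_mono divide_right_mono sum_mono integral_mono)
    show "integrable M (\<lambda>y. \<Sum>i\<in>I. p i * h i y)" by (auto intro!: int_h)
    show "integrable M (\<lambda>y. E * (exp (l * S y) + exp (- l * S y)))"
      by (intro integrable_mult_right Bochner_Integration.integrable_add integrable_exp_bounded[OF Sm Sb])
  qed (use avg x in auto)
  also have "\<dots> = E * J (\<lambda>y. exp (l * S y) + exp (- l * S y))"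
    unfolding J distrib_left[of E "integral\<^sup>L M _"] by (simp flip: sum_distrib_left)
  also have "\<dots> \<le> E * (4 * E ^ k)"
    using le unfolding S_def by (intro mult_left_mono) (auto simp: E_def)
  finally have tot: "(\<Sum>i\<in>I. p i * J (h i)) \<le> 4 * E ^ Suc k" by simp
  \<comment> \<open>The \<open>p\<close>-average of \<open>J (h i)\<close> obeys the bound, so some
    single \<open>i\<close> does, and it extends the list. One choice serves both measures because
    \<open>J\<close> adds them.\<close>
  have "\<exists>i\<in>I. J (h i) \<le> 4 * E ^ Suc k"
  proof (rule ccontr)
    assume neg: "\<not> ?thesis"
    obtain i0 where i0: "i0 \<in> I" "p i0 > 0"
      using p by (metis less_eq_real_def sum.neutral zero_neq_one)
    have "(\<Sum>i\<in>I. p i * (4 * E ^ Suc k)) < (\<Sum>i\<in>I. p i * J (h i))"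
      using neg i0 p(1) by (intro sum_strict_mono_ex1 fin) (auto intro!: mult_left_mono bexI[of _ i0] simp: not_le)
    then show False using tot p(2) by (simp flip: sum_distrib_right)
  qed
  then obtain i where i: "i \<in> I" "J (h i) \<le> 4 * E ^ Suc k" by blast
  have hi: "h i = (\<lambda>y. exp (l * ((\<Sum>i\<leftarrow>i # ks. \<psi> i y) - real (Suc k) * F y)) +
       exp (- l * ((\<Sum>i\<leftarrow>i # ks. \<psi> i y) - real (Suc k) * F y)))"
  proof
    fix y
    have "S y + (\<psi> i y - F y) = (\<Sum>i\<leftarrow>i # ks. \<psi> i y) - real (Suc k) * F y"
      by (simp add: S_def algebra_simps)
    then show "h i y = exp (l * ((\<Sum>i\<leftarrow>i # ks. \<psi> i y) - real (Suc k) * F y)) +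
       exp (- l * ((\<Sum>i\<leftarrow>i # ks. \<psi> i y) - real (Suc k) * F y))"
      unfolding h_def by (simp only:)
  qed
  show ?case
    using i ks unfolding E_def hi by (intro exI[of _ "i # ks"]) auto
qed

text \<open>Markov's inequality for the exponential moment of \<open>maurey_exp\<close>, read off in
  each half of \<open>J\<close> separately, which is possible because both halves are
  nonnegative.\<close>

lemma (in prob_space) maurey:
  fixes u :: real and \<psi> :: "'i \<Rightarrow> 'a \<Rightarrow> real" and p :: "'i \<Rightarrow> real" and x :: "nat \<Rightarrow> 'a"
  assumes fin: "finite I" and p: "\<And>i. i \<in> I \<Longrightarrow> p i \<ge> 0" "sum p I = 1"
    and \<psi>: "\<And>i. i \<in> I \<Longrightarrow> \<psi> i \<in> borel_measurable M"
    and b: "\<And>i y. i \<in> I \<Longrightarrow> y \<in> space M \<Longrightarrow> \<bar>\<psi> i y\<bar> \<le> b" "b > 0"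
    and x: "\<And>j. j < m \<Longrightarrow> x j \<in> space M"
    and k: "k > 0" and u: "u > 0"
  defines "F \<equiv> \<lambda>y. \<Sum>i\<in>I. p i * \<psi> i y"
  shows "\<exists>ks. length ks = k \<and> set ks \<subseteq> I \<and>
     prob {y \<in> space M. u \<le> \<bar>(\<Sum>i\<leftarrow>ks. \<psi> i y) / real k - F y\<bar>} \<le> 4 * exp (- real k * u\<^sup>2 / (16 * b\<^sup>2)) \<and>
     (\<Sum>j<m. of_bool (u \<le> \<bar>(\<Sum>i\<leftarrow>ks. \<psi> i (x j)) / real k - F (x j)\<bar>)) \<le>
        4 * exp (- real k * u\<^sup>2 / (16 * b\<^sup>2)) * real m"
proof -
  \<comment> \<open>Minimises \<open>4 * l\<^sup>2 * b\<^sup>2 - l * u\<close>; the minimum is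
    \<open>- u\<^sup>2 / (16 * b\<^sup>2)\<close>.\<close>
  define l where "l = u / (8 * b\<^sup>2)"
  have l: "l > 0" using u b(2) by (simp add: l_def)
  obtain ks where ks: "length ks = k" "set ks \<subseteq> I" and
    J: "(\<integral>y. (exp (l * ((\<Sum>i\<leftarrow>ks. \<psi> i y) - real k * F y)) + exp (- l * ((\<Sum>i\<leftarrow>ks. \<psi> i y) - real k * F y))) \<partial>M) +
     (\<Sum>j<m. exp (l * ((\<Sum>i\<leftarrow>ks. \<psi> i (x j)) - real k * F (x j))) + exp (- l * ((\<Sum>i\<leftarrow>ks. \<psi> i (x j)) - real k * F (x j)))) / real m
     \<le> 4 * exp (4 * l\<^sup>2 * b\<^sup>2) ^ k"
    using maurey_exp[of I p \<psi> b m x F _ k l, OF fin p \<psi> b(1) x _ refl] F_def by blast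
  define T where "T y = (\<Sum>i\<leftarrow>ks. \<psi> i y) - real k * F y" for y
  define h where "h y = exp (l * T y) + exp (- l * T y)" for y
  define Q where "Q = exp (l * real k * u)"
  define bad where "bad y \<longleftrightarrow> u \<le> \<bar>(\<Sum>i\<leftarrow>ks. \<psi> i y) / real k - F y\<bar>" for y
  have hpos: "h y \<ge> 0" for y by (simp add: h_def add_nonneg_nonneg)
  have badh: "of_bool (bad y) \<le> h y / Q" for y
  proof (cases "bad y")
    case True
    have "\<bar>(\<Sum>i\<leftarrow>ks. \<psi> i y) / real k - F y\<bar> = \<bar>T y\<bar> / real k"
      using k by (simp add: T_def diff_divide_distrib abs_divide[symmetric] del: abs_divide)
         (simp add: field_simps)
    then have "real k * u \<le> \<bar>T y\<bar>" using True k by (simp add: bad_def field_simps)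
    then have "l * (real k * u) \<le> l * \<bar>T y\<bar>" using l by (intro mult_left_mono) auto
    then have "Q \<le> exp (l * \<bar>T y\<bar>)" by (simp add: Q_def mult.assoc)
    also have "\<dots> \<le> h y" by (cases "T y \<ge> 0") (auto simp: h_def)
    finally show ?thesis using True by (simp add: Q_def)
  next
    case False
    then show ?thesis using hpos by (simp add: Q_def)
  qed
  have Fm: "F \<in> borel_measurable M" unfolding F_def using \<psi> by measurable
  have lm: "(\<lambda>y. \<Sum>i\<leftarrow>ks. \<psi> i y) \<in> borel_measurable M"
    using ks(2) by (intro borel_measurable_sum_list \<psi>) auto
  have Tm: "T \<in> borel_measurable M" unfolding T_def using lm Fm by measurable
  have Fb: "\<bar>F y\<bar> \<le> b" if "y \<in> space M" for y
    unfolding F_def using p b(1)[OF _ that] by (intro convex_sum_abs_le)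
  have Tb: "\<bar>T y\<bar> \<le> real k * b + real k * b" if y: "y \<in> space M" for y
  proof -
    have "\<bar>\<Sum>i\<leftarrow>ks. \<psi> i y\<bar> \<le> real (length ks) * b"
      using ks(2) b(1)[OF _ y] by (intro sum_list_abs_le) auto
    moreover have "\<bar>real k * F y\<bar> \<le> real k * b"
      using Fb[OF y] by (simp add: abs_mult mult_left_mono)
    ultimately show ?thesis unfolding T_def ks(1) by linarith
  qed
  have int_h: "integrable M h"
    unfolding h_def by (intro Bochner_Integration.integrable_add integrable_exp_bounded[OF Tm Tb])
  define R where "R = 4 * exp (4 * l\<^sup>2 * b\<^sup>2) ^ k"
  have J': "(\<integral>y. h y \<partial>M) + (\<Sum>j<m. h (x j)) / real m \<le> R"
    using J unfolding h_def T_def R_def .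
  have "R / Q = 4 * exp (real k * (4 * l\<^sup>2 * b\<^sup>2) - l * real k * u)"
    by (simp add: R_def Q_def exp_diff exp_of_nat_mult)
  also have "real k * (4 * l\<^sup>2 * b\<^sup>2) - l * real k * u = - real k * u\<^sup>2 / (16 * b\<^sup>2)"
    using b(2) by (simp add: l_def field_simps power2_eq_square)
  finally have RQ: "R / Q = 4 * exp (- real k * u\<^sup>2 / (16 * b\<^sup>2))" .
  have Q: "Q > 0" by (simp add: Q_def)
  have h0: "(\<integral>y. h y \<partial>M) \<ge> 0" "(\<Sum>j<m. h (x j)) / real m \<ge> 0"
    using hpos by (auto intro!: sum_nonneg divide_nonneg_nonneg)
  have "prob {y \<in> space M. bad y} = (\<integral>y. indicat_real {y \<in> space M. bad y} y \<partial>M)"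
    unfolding bad_def using lm Fm by simp
  also have "\<dots> \<le> (\<integral>y. h y / Q \<partial>M)"
  proof (rule integral_mono)
    show "integrable M (indicat_real {y \<in> space M. bad y})"
      unfolding bad_def using lm Fm by (intro integrable_real_indicator) (auto simp: emeasure_eq_measure)
    show "indicat_real {y \<in> space M. bad y} y \<le> h y / Q" if "y \<in> space M" for y
      using badh[of y] that by (simp add: indicator_def)
  qed (use int_h in auto)
  also have "\<dots> \<le> R / Q" using J' h0 Q by (simp add: divide_right_mono)
  finally have 1: "prob {y \<in> space M. bad y} \<le> R / Q" .
  have "(\<Sum>j<m. of_bool (bad (x j))) \<le> (\<Sum>j<m. h (x j) / Q)"
    by (rule sum_mono) (rule badh)
  also have "\<dots> = (\<Sum>j<m. h (x j)) / Q" by (simp add: sum_divide_distrib)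
  also have "\<dots> \<le> R / Q * real m"
  proof (cases "m = 0")
    case False
    then have "(\<Sum>j<m. h (x j)) \<le> R * real m" using J' h0 by (simp add: pos_divide_le_eq[symmetric])
    then show ?thesis using Q by (simp add: field_simps)
  qed simp
  finally show ?thesis using 1 ks unfolding RQ bad_def by blast
qed


section \<open>Dyadic levels and the choice of the points\<close>

lemma (in prob_space) exists_dyadic_level:
  fixes F :: "'a \<Rightarrow> real"
  assumes F: "F \<in> borel_measurable M" and b: "\<And>y. y \<in> space M \<Longrightarrow> \<bar>F y\<bar> \<le> b"
    and one: "(\<integral>y. (F y)\<^sup>2 \<partial>M) = 1" and \<Lambda>: "2 * b < 2 ^ \<Lambda>"
  shows "\<exists>l<\<Lambda>. 3 / (4 * real \<Lambda> * 4 ^ l) \<le> prob {y \<in> space M. 2 ^ l / 2 \<le> \<bar>F y\<bar>}"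
proof (rule ccontr)
  assume neg: "\<not> ?thesis"
  define V where "V l = {y \<in> space M. 2 ^ l / 2 \<le> \<bar>F y\<bar>}" for l :: nat
  have V: "V l \<in> sets M" for l unfolding V_def using F by measurable
  have "\<Lambda> \<noteq> 0"
  proof
    assume "\<Lambda> = 0"
    then have b': "b \<le> 1/2" using \<Lambda> by simp
    have "(F y)\<^sup>2 \<le> 1/4" if "y \<in> space M" for y
    proof -
      have "\<bar>F y\<bar> \<le> \<bar>1/2\<bar>" using b[OF that] b' by simp
      then have "(F y)\<^sup>2 \<le> (1/2)\<^sup>2" by (simp only: abs_le_square_iff)
      then show ?thesis by (simp add: power2_eq_square)
    qed
    then have "(\<integral>y. (F y)\<^sup>2 \<partial>M) \<le> (\<integral>y. 1/4 \<partial>M)"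
      by (intro integral_mono') auto
    then show False using one by (simp add: prob_space)
  qed
  \<comment> \<open>If \<open>2^l \<le> 2 |F y| < 2^(l+1)\<close>, the square is below
    \<open>4^l\<close> and the indicator at level \<open>l\<close> is 1; values below 1/2 are
    covered by the constant 1/4. Were every level set smaller than claimed, integration would give
    less than 1/4 + 3/4.\<close>
  have pw: "(F y)\<^sup>2 \<le> 1/4 + (\<Sum>l<\<Lambda>. 4 ^ l * indicat_real (V l) y)" if y: "y \<in> space M" for y
  proof (cases "\<bar>F y\<bar> < 1/2")
    case True
    then have "\<bar>F y\<bar> \<le> \<bar>1/2\<bar>" by simp
    then have "(F y)\<^sup>2 \<le> (1/2)\<^sup>2" by (simp only: abs_le_square_iff)
    moreover have "(\<Sum>l<\<Lambda>. 4 ^ l * indicat_real (V l) y) \<ge> 0" by (intro sum_nonneg) auto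
    ultimately show ?thesis by (simp add: power2_eq_square)
  next
    case False
    define n where "n = (LEAST n. 2 * \<bar>F y\<bar> < 2 ^ n)"
    have ex: "2 * \<bar>F y\<bar> < 2 ^ \<Lambda>" using b[OF y] \<Lambda> by linarith
    then have n1: "2 * \<bar>F y\<bar> < 2 ^ n" and n2: "n \<le> \<Lambda>"
      unfolding n_def by (rule LeastI, rule Least_le)
    have "n \<noteq> 0" using n1 False by (intro notI) simp
    then obtain l where l: "n = Suc l" by (cases n) auto
    then have "\<not> 2 * \<bar>F y\<bar> < 2 ^ l" using not_less_Least[of l "\<lambda>n. 2 * \<bar>F y\<bar> < 2 ^ n"] n_def by simp
    then have yV: "y \<in> V l" using y by (simp add: V_def)
    have "\<bar>F y\<bar> \<le> \<bar>2 ^ l\<bar>" using n1 l by simp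
    then have "(F y)\<^sup>2 \<le> (2 ^ l)\<^sup>2" by (simp only: abs_le_square_iff)
    also have "\<dots> = 4 ^ l * indicat_real (V l) y" using yV by (simp add: power2_eq_square flip: power_mult_distrib)
    also have "\<dots> \<le> (\<Sum>l<\<Lambda>. 4 ^ l * indicat_real (V l) y)"
      using l n2 by (intro member_le_sum) auto
    finally show ?thesis by simp
  qed
  have "1 = (\<integral>y. (F y)\<^sup>2 \<partial>M)" using one by simp
  also have "\<dots> \<le> (\<integral>y. 1/4 + (\<Sum>l<\<Lambda>. 4 ^ l * indicat_real (V l) y) \<partial>M)"
  proof (rule integral_mono')
    show "integrable M (\<lambda>y. 1/4 + (\<Sum>l<\<Lambda>. 4 ^ l * indicat_real (V l) y))"
      using V by (intro Bochner_Integration.integrable_add Bochner_Integration.integrable_sum integrable_mult_right)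
        (auto simp: emeasure_eq_measure)
    show "0 \<le> 1/4 + (\<Sum>l<\<Lambda>. 4 ^ l * indicat_real (V l) y)" for y
      by (intro add_nonneg_nonneg sum_nonneg) auto
  qed (rule pw)
  also have "\<dots> = 1/4 + (\<Sum>l<\<Lambda>. 4 ^ l * prob (V l))"
  proof -
    have int: "integrable M (\<lambda>y. 4 ^ l * indicat_real (V l) y)" for l
      using V by (intro integrable_mult_right) (auto simp: emeasure_eq_measure)
    have "(\<integral>y. (\<Sum>l<\<Lambda>. 4 ^ l * indicat_real (V l) y) \<partial>M) = (\<Sum>l<\<Lambda>. \<integral>y. 4 ^ l * indicat_real (V l) y \<partial>M)"
      by (rule Bochner_Integration.integral_sum) (rule int)
    also have "\<dots> = (\<Sum>l<\<Lambda>. 4 ^ l * prob (V l))" using V by simp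
    finally have eq: "(\<integral>y. (\<Sum>l<\<Lambda>. 4 ^ l * indicat_real (V l) y) \<partial>M) = (\<Sum>l<\<Lambda>. 4 ^ l * prob (V l))" .
    show ?thesis
      by (subst Bochner_Integration.integral_add)
         (auto simp only: eq prob_space lebesgue_integral_const integrable_const
           intro!: Bochner_Integration.integrable_sum int, simp add: prob_space)
  qed
  also have "\<dots> < 1/4 + (\<Sum>l<\<Lambda>. 3 / (4 * real \<Lambda>))"
  proof (intro add_strict_left_mono sum_strict_mono)
    fix l assume "l \<in> {..<\<Lambda>}"
    then have "prob (V l) < 3 / (4 * real \<Lambda> * 4 ^ l)" using neg by (auto simp: V_def not_le)
    then show "4 ^ l * prob (V l) < 3 / (4 * real \<Lambda>)"
      using \<open>\<Lambda> \<noteq> 0\<close> by (simp add: field_simps)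
  qed (use \<open>\<Lambda> \<noteq> 0\<close> in auto)
  also have "\<dots> = 1" using \<open>\<Lambda> \<noteq> 0\<close> by simp
  finally show False by simp
qed

text \<open>The mass by which \<open>\<parallel>c\<parallel>\<^sub>1\<close> falls short of \<open>A\<close> is distributed evenly over \<open>\<plusminus>A e\<^sub>0\<close>.\<close>

lemma l1_ball_convex_combination:
  fixes c :: "nat \<Rightarrow> real"
  assumes "(\<Sum>k\<le>N. \<bar>c k\<bar>) \<le> A" "A > 0"
  shows "\<exists>p. (\<forall>i. p i \<ge> 0) \<and> sum p ({..N} \<times> UNIV) = 1 \<and>
    (\<forall>\<phi>::nat \<Rightarrow> real. (\<Sum>i\<in>{..N} \<times> UNIV. p i * ((if snd i then A else - A) * \<phi> (fst i))) = (\<Sum>k\<le>N. c k * \<phi> k))"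
proof -
  define r where "r = 1 - (\<Sum>k\<le>N. \<bar>c k\<bar>) / A"
  have r: "r \<ge> 0" using assms by (simp add: r_def)
  define p where "p i = (\<bar>c (fst i)\<bar> + (if snd i then c (fst i) else - c (fst i))) / (2 * A) +
      (if fst i = 0 then r / 2 else 0)" for i :: "nat \<times> bool"
  have S: "(\<Sum>i\<in>{..N} \<times> UNIV. f i) = (\<Sum>k\<le>N. f (k, True) + f (k, False))" for f :: "nat \<times> bool \<Rightarrow> real"
  proof -
    have "(\<Sum>i\<in>{..N} \<times> UNIV. f i) = (\<Sum>k\<le>N. \<Sum>b\<in>UNIV. f (k, b))"
      by (simp add: sum.cartesian_product)
    then show ?thesis by (simp add: UNIV_bool add.commute)
  qed
  have "p i \<ge> 0" for i
  proof -
    have "\<bar>c (fst i)\<bar> + (if snd i then c (fst i) else - c (fst i)) \<ge> 0"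
      by (cases "snd i") auto
    then have "(\<bar>c (fst i)\<bar> + (if snd i then c (fst i) else - c (fst i))) / (2 * A) \<ge> 0"
      using assms(2) by (intro divide_nonneg_nonneg) simp_all
    moreover have "(if fst i = 0 then r / 2 else 0) \<ge> 0" using r by simp
    ultimately show ?thesis unfolding p_def by (rule add_nonneg_nonneg)
  qed
  moreover have "sum p ({..N} \<times> UNIV) = 1"
  proof -
    have "p (k, True) + p (k, False) = \<bar>c k\<bar> / A + (if k = 0 then r else 0)" for k
      using assms by (simp add: p_def field_simps)
    then have "sum p ({..N} \<times> UNIV) = (\<Sum>k\<le>N. \<bar>c k\<bar> / A) + (\<Sum>k\<le>N. if k = 0 then r else 0)"
      by (simp add: S sum.distrib)
    also have "\<dots> = 1" by (simp add: r_def sum_divide_distrib)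
    finally show ?thesis .
  qed
  moreover have "(\<Sum>i\<in>{..N} \<times> UNIV. p i * ((if snd i then A else - A) * \<phi> (fst i))) = (\<Sum>k\<le>N. c k * \<phi> k)"
    for \<phi> :: "nat \<Rightarrow> real"
    unfolding S using assms by (intro sum.cong) (auto simp: p_def field_simps)
  ultimately show ?thesis by blast
qed


text \<open>A point where the average reaches \<open>3/4 * T\<close> and the approximation error is
  below \<open>T / 4\<close> satisfies \<open>|F| \<ge> T / 2 \<ge> 1/4\<close>, as every level has
  \<open>T \<ge> 1/2\<close>. It exists because the average is hit at least
  \<open>3/8 * a l * m\<close> times, while at most \<open>a l * m / 4\<close> points are
  exceptional.\<close>

theorem (in prob_space) bounded_orthonormal_system_points:
  fixes \<phi> :: "nat \<Rightarrow> 'a \<Rightarrow> real" and A K b :: real and N m :: nat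
  assumes meas: "\<And>k. k \<le> N \<Longrightarrow> \<phi> k \<in> borel_measurable M"
    and bound: "\<And>k y. k \<le> N \<Longrightarrow> y \<in> space M \<Longrightarrow> \<bar>\<phi> k y\<bar> \<le> K"
    and orth: "\<And>k j. k \<le> N \<Longrightarrow> j \<le> N \<Longrightarrow> (\<integral>y. \<phi> k y * \<phi> j y \<partial>M) = of_bool (k = j)"
    and A: "A > 0" and K: "K > 0" and b_def: "b = A * K" and b: "b \<ge> 2"
    and m: "real m \<ge> 4000000 * b\<^sup>2 * (ln b)\<^sup>2 * ln (2 * (real N + 1))"
  shows "\<exists>x. (\<forall>j<m. x j \<in> space M) \<and>
    (\<forall>c. (\<Sum>k\<le>N. (c k)\<^sup>2) = 1 \<and> (\<Sum>k\<le>N. \<bar>c k\<bar>) \<le> A \<longrightarrow>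
       (\<exists>j<m. 1/4 \<le> \<bar>\<Sum>k\<le>N. c k * \<phi> k (x j)\<bar>))"
proof -
  \<comment> \<open>The number of levels: \<open>F c\<close> is bounded by \<open>b\<close>, so no
    level from \<open>\<Lambda>\<close> on is reached, and minimality gives a multiple of
    \<open>ln b\<close>.\<close>
  define \<Lambda> where "\<Lambda> = (LEAST n. 2 * b < 2 ^ n)"
  obtain n0 where "2 * b < 2 ^ n0" using real_arch_pow[of 2 "2 * b"] by auto
  then have \<Lambda>1: "2 * b < 2 ^ \<Lambda>" unfolding \<Lambda>_def by (rule LeastI)
  have \<Lambda>0: "\<Lambda> \<noteq> 0" using \<Lambda>1 b by (intro notI) simp
  then obtain n where n: "\<Lambda> = Suc n" by (cases \<Lambda>) auto
  then have "\<not> 2 * b < 2 ^ n" using not_less_Least[of n "\<lambda>n. 2 * b < 2 ^ n"] \<Lambda>_def by simp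
  then have \<Lambda>2: "2 ^ n \<le> 2 * b" by simp
  have \<Lambda>4b: "real \<Lambda> \<le> 4 * b"
  proof -
    have "real \<Lambda> \<le> 2 ^ \<Lambda>" by (metis less_exp less_imp_le numeral_power_le_of_nat_cancel_iff of_nat_le_numeral_power_cancel_iff)
    then show ?thesis using \<Lambda>2 n by simp
  qed
  have ln2: "ln 2 \<ge> (2/3::real)" by (rule ln2_ge_two_thirds)
  have lnb: "ln b \<ge> ln 2" using b by simp
  have lnb0: "ln b > 0" using b by simp
  have \<Lambda>ln: "real \<Lambda> \<le> 5 * ln b"
  proof -
    have "2 ^ \<Lambda> \<le> 4 * b" using \<Lambda>2 n by simp
    then have "ln (2 ^ \<Lambda>) \<le> ln (4 * b)" using b by (subst ln_le_cancel_iff) auto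
    also have "ln (4 * b) = ln (2 ^ 2) + ln b" using b by (subst ln_mult) auto
    also have "ln (2 ^ 2 :: real) = 2 * ln 2" by (subst ln_realpow) auto
    finally have "real \<Lambda> * ln 2 \<le> 3 * ln b" using lnb by (simp add: ln_realpow)
    moreover have "real \<Lambda> * (2/3) \<le> real \<Lambda> * ln 2" using ln2 by (intro mult_left_mono) auto
    ultimately show ?thesis using lnb0 by linarith
  qed
  define T :: "nat \<Rightarrow> real" where "T l = 2 ^ l / 2" for l
  have T0: "T l \<ge> 1/2" for l by (simp add: T_def)
  have T0': "T l > 0" for l by (simp add: T_def)
  have Tb: "T l \<le> b" if "l < \<Lambda>" for l
  proof -
    have "(2::real) ^ l \<le> 2 ^ n" using that n by (intro power_increasing) auto
    then have "2 ^ l \<le> 2 * b" using \<Lambda>2 by (rule order_trans)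
    then show ?thesis by (simp add: T_def)
  qed
  have T2b: "(T l)\<^sup>2 \<le> b\<^sup>2" if "l < \<Lambda>" for l
    using Tb[OF that] T0'[of l] by (intro power_mono) auto
  define a where "a l = 3 / (16 * real \<Lambda> * (T l)\<^sup>2)" for l
  have a_alt: "a l = 3 / (4 * real \<Lambda> * 4 ^ l)" for l
  proof -
    have "(2 ^ l)\<^sup>2 = (4::real) ^ l" by (simp add: power2_eq_square flip: power_mult_distrib)
    then show ?thesis by (simp add: a_def T_def power_divide)
  qed
  have a0: "a l > 0" for l using \<Lambda>0 T0'[of l] by (simp add: a_def)
  \<comment> \<open>3072 = 12 * 16 * 16 makes the exponent of \<open>maurey\<close> at deviation
    \<open>T l / 4\<close> at most \<open>- 12 * ln b\<close>. The power 12 brings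
    \<open>4 / b ^ 12\<close> below \<open>a l / 4\<close>, which is bounded below by a multiple of
    \<open>1 / b ^ 3\<close>.\<close>
  define H where "H l = 3072 * b\<^sup>2 * ln b / (T l)\<^sup>2" for l
  define k where "k l = nat \<lceil>H l\<rceil>" for l
  have Hln: "H l \<ge> 3072 * ln b" if "l < \<Lambda>" for l
  proof -
    have "3072 * ln b * (T l)\<^sup>2 \<le> 3072 * ln b * b\<^sup>2" using T2b[OF that] lnb0 by (intro mult_left_mono) auto
    then show ?thesis using T0'[of l] by (simp add: H_def field_simps)
  qed
  have H1: "H l \<ge> 1" if "l < \<Lambda>" for l using Hln[OF that] lnb ln2 by linarith
  have kH: "H l \<le> real (k l)" for l unfolding k_def by linarith
  have k2H: "real (k l) \<le> 2 * H l" if "l < \<Lambda>" for l unfolding k_def using H1[OF that] by linarith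
  have k0: "k l > 0" if "l < \<Lambda>" for l using H1[OF that] kH[of l] by (intro Nat.gr0I) auto
  define Y where "Y = ln (2 * (real N + 1))"
  have Y: "Y \<ge> 2/3"
  proof -
    have "ln 2 \<le> Y" unfolding Y_def by simp
    then show ?thesis using ln2 by linarith
  qed
  have m0: "real m > 0"
  proof -
    have "4000000 * b\<^sup>2 * (ln b)\<^sup>2 * Y > 0" using b lnb0 Y by simp
    then show ?thesis using m unfolding Y_def by linarith
  qed

  define I where "I = {..N} \<times> (UNIV :: bool set)"
  define \<psi> where "\<psi> i y = (if snd i then A else - A) * \<phi> (fst i) y" for i :: "nat \<times> bool" and y
  have finI: "finite I" and cardI: "card I = 2 * (N + 1)" by (auto simp: I_def card_cartesian_product)
  have \<psi>m: "\<psi> i \<in> borel_measurable M" if "i \<in> I" for i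
    unfolding \<psi>_def using that meas by (auto simp: I_def)
  have \<psi>b: "\<bar>\<psi> i y\<bar> \<le> b" if "i \<in> I" "y \<in> space M" for i y
    unfolding \<psi>_def b_def using that bound[of "fst i" y] A by (auto simp: I_def abs_mult)
  define G where "G l ks y = (\<Sum>i\<leftarrow>ks. \<psi> i y) / real (k l)" for l ks y
  define U where "U l ks = {y \<in> space M. 3/4 * T l \<le> \<bar>G l ks y\<bar>}" for l ks
  have Gm: "G l ks \<in> borel_measurable M" if "set ks \<subseteq> I" for l ks
  proof -
    have "(\<lambda>y. \<Sum>i\<leftarrow>ks. \<psi> i y) \<in> borel_measurable M"
      using that by (intro borel_measurable_sum_list \<psi>m) auto
    then show ?thesis unfolding G_def by simp
  qed
  have Um: "U l ks \<in> sets M" if "set ks \<subseteq> I" for l ks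
    unfolding U_def using Gm[OF that, of l] by measurable
  define L where "L l = {ks. set ks \<subseteq> I \<and> length ks = k l}" for l
  have finL: "finite (L l)" for l unfolding L_def by (rule finite_lists_length_eq[OF finI])
  have cardL: "real (card (L l)) = exp (real (k l) * Y)" for l
  proof -
    have "exp Y = real (2 * (N + 1))" by (simp add: Y_def)
    then show ?thesis
      unfolding L_def exp_of_nat_mult by (subst card_lists_length_eq[OF finI]) (simp add: cardI)
  qed
  \<comment> \<open>Defined without \<open>c\<close> and without the points, so that the points can
    be chosen first.\<close>
  define X where "X = {(l, ks) \<in> Sigma {..<\<Lambda>} L. 3/4 * a l \<le> prob (U l ks)}"
  have X_sub: "X \<subseteq> Sigma {..<\<Lambda>} L" by (auto simp: X_def)
  have finX: "finite X" using finL by (intro finite_subset[OF X_sub] finite_SigmaI) auto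
  have term_le: "exp (real (k l) * Y) * exp (- (3/4 * a l) * real m / 10) \<le> 1 / b ^ 4" if l: "l < \<Lambda>" for l
  proof -
    \<comment> \<open>Two of the three \<open>H l * Y\<close> pay for the logarithm of the number of
      lists; the third exceeds \<open>4 * ln b\<close> and leaves at most \<open>1 / b ^ 4\<close>
      per level. The constant 4000000 covers 3 * 3072 * 640 * 5 / 9, where 5 is the constant of
      \<open>\<Lambda>ln\<close>.\<close>
    have "3 * H l * Y \<le> (3/4 * a l) * real m / 10"
    proof -
      have "3 * H l * Y * (640 * real \<Lambda> * (T l)\<^sup>2) = 5898240 * b\<^sup>2 * ln b * Y * real \<Lambda>"
        using T0'[of l] by (simp add: H_def)
      also have "\<dots> \<le> 5898240 * b\<^sup>2 * ln b * Y * (5 * ln b)"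
        using \<Lambda>ln lnb0 Y by (intro mult_left_mono) auto
      also have "\<dots> \<le> 9 * (4000000 * b\<^sup>2 * (ln b)\<^sup>2 * Y)"
      proof -
        have "b\<^sup>2 * (ln b)\<^sup>2 * Y \<ge> 0" using Y by simp
        then show ?thesis by (simp add: power2_eq_square mult_ac)
      qed
      also have "\<dots> \<le> 9 * real m" using m unfolding Y_def by (intro mult_left_mono) auto
      finally have "3 * H l * Y \<le> 9 * real m / (640 * real \<Lambda> * (T l)\<^sup>2)"
        using \<Lambda>0 T0'[of l] by (subst pos_le_divide_eq) auto
      also have "\<dots> = (3/4 * a l) * real m / 10" by (simp add: a_def)
      finally show ?thesis .
    qed
    moreover have "real (k l) * Y \<le> 2 * H l * Y" using k2H[OF l] Y by (intro mult_right_mono) auto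
    moreover have "4 * ln b \<le> H l * Y"
    proof -
      have "4 * ln b \<le> (3072 * ln b) * (2/3)" using lnb0 by simp
      also have "\<dots> \<le> H l * Y" using Hln[OF l] Y lnb0 H1[OF l] by (intro mult_mono) auto
      finally show ?thesis .
    qed
    ultimately have "real (k l) * Y + - (3/4 * a l) * real m / 10 \<le> - (4 * ln b)" by linarith
    then have "exp (real (k l) * Y + - (3/4 * a l) * real m / 10) \<le> exp (- (real 4 * ln b))" by simp
    also have "exp (- (real 4 * ln b)) = 1 / b ^ 4"
      unfolding exp_minus exp_of_nat_mult using b by (simp add: inverse_eq_divide)
    finally show ?thesis unfolding exp_add .
  qed
  have "(\<Sum>(l, ks)\<in>X. exp (- (3/4 * a l) * real m / 10)) \<le>
      (\<Sum>(l, ks)\<in>Sigma {..<\<Lambda>} L. exp (- (3/4 * a l) * real m / 10))"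
    using X_sub finL by (intro sum_mono2) auto
  also have "\<dots> = (\<Sum>l<\<Lambda>. \<Sum>ks\<in>L l. exp (- (3/4 * a l) * real m / 10))"
    using finL by (subst sum.Sigma) auto
  also have "\<dots> = (\<Sum>l<\<Lambda>. exp (real (k l) * Y) * exp (- (3/4 * a l) * real m / 10))"
    by (simp only: sum_constant cardL)
  also have "\<dots> \<le> (\<Sum>l<\<Lambda>. 1 / b ^ 4)" by (intro sum_mono term_le) auto
  also have "\<dots> = real \<Lambda> / b ^ 4" by simp
  also have "\<dots> \<le> 4 * b / b ^ 4" using \<Lambda>4b b by (intro divide_right_mono) auto
  also have "\<dots> = 4 / b ^ 3" using b by (simp add: power_eq_if)
  also have "\<dots> < 1"
  proof -
    have "(2::real) ^ 3 \<le> b ^ 3" using b by (intro power_mono) auto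
    then have "4 < b ^ 3" by simp
    then show ?thesis by (subst divide_less_eq_1_pos) linarith+
  qed
  finally have small: "(\<Sum>i\<in>X. exp (- (3/4 * a (fst i)) * real m / 10)) < 1"
    by (simp add: case_prod_beta)
  obtain x where x: "\<forall>j<m. x j \<in> space M" and
    cnt: "\<forall>i\<in>X. 3/4 * a (fst i) * real m / 2 \<le> (\<Sum>j<m. indicat_real (U (fst i) (snd i)) (x j))"
    using exists_points_hitting[of X "\<lambda>i. U (fst i) (snd i)" "\<lambda>i. 3/4 * a (fst i)" m, OF finX _ _ small]
      Um by (auto simp: X_def L_def)
  have "\<exists>j<m. 1/4 \<le> \<bar>\<Sum>k\<le>N. c k * \<phi> k (x j)\<bar>"
    if c2: "(\<Sum>k\<le>N. (c k)\<^sup>2) = 1" and c1: "(\<Sum>k\<le>N. \<bar>c k\<bar>) \<le> A" for c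
  proof -
    obtain p where p0: "\<And>i. p i \<ge> 0" and p1: "sum p I = 1" and
      p2: "\<And>\<phi>::nat \<Rightarrow> real. (\<Sum>i\<in>I. p i * ((if snd i then A else - A) * \<phi> (fst i))) = (\<Sum>k\<le>N. c k * \<phi> k)"
      using l1_ball_convex_combination[OF c1 A] unfolding I_def by blast
    define F where "F y = (\<Sum>k\<le>N. c k * \<phi> k y)" for y
    have F_alt: "(\<Sum>i\<in>I. p i * \<psi> i y) = F y" for y
      unfolding F_def \<psi>_def using p2[of "\<lambda>k. \<phi> k y"] by simp
    have Fm: "F \<in> borel_measurable M" unfolding F_def using meas by measurable
    have Fb: "\<bar>F y\<bar> \<le> b" if "y \<in> space M" for y
      unfolding F_alt[symmetric] using p0 p1 \<psi>b that by (intro convex_sum_abs_le) auto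
    have F2: "(\<integral>y. (F y)\<^sup>2 \<partial>M) = 1"
    proof -
      have int: "integrable M (\<lambda>y. \<phi> k y * \<phi> j y)" if "k \<le> N" "j \<le> N" for k j
      proof (rule integrable_const_bound[of _ "K * K"])
        show "AE y in M. norm (\<phi> k y * \<phi> j y) \<le> K * K"
          using bound that K by (intro AE_I2) (auto simp: abs_mult intro!: mult_mono)
      qed (use meas that in measurable)
      have "(F y)\<^sup>2 = (\<Sum>k\<le>N. \<Sum>j\<le>N. c k * c j * (\<phi> k y * \<phi> j y))" for y
        unfolding F_def power2_eq_square sum_product by (intro sum.cong) (auto simp: mult_ac)
      then have "(\<integral>y. (F y)\<^sup>2 \<partial>M) = (\<integral>y. (\<Sum>k\<le>N. \<Sum>j\<le>N. c k * c j * (\<phi> k y * \<phi> j y)) \<partial>M)" by simp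
      also have "\<dots> = (\<Sum>k\<le>N. \<Sum>j\<le>N. c k * c j * (\<integral>y. \<phi> k y * \<phi> j y \<partial>M))"
        using int by (subst Bochner_Integration.integral_sum, force intro!: Bochner_Integration.integrable_sum)
          (auto intro!: sum.cong simp: Bochner_Integration.integral_sum)
      also have "\<dots> = (\<Sum>k\<le>N. \<Sum>j\<le>N. if k = j then c k * c j else 0)"
        by (intro sum.cong) (auto simp: orth)
      also have "\<dots> = 1" using c2 by (simp add: power2_eq_square)
      finally show ?thesis .
    qed
    obtain l where l: "l < \<Lambda>" and lev: "a l \<le> prob {y \<in> space M. T l \<le> \<bar>F y\<bar>}"
      using exists_dyadic_level[OF Fm Fb F2 \<Lambda>1] unfolding a_alt T_def by blast
    define e where "e = 4 * exp (- real (k l) * (T l / 4)\<^sup>2 / (16 * b\<^sup>2))"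
    have e: "e \<le> a l / 4"
    proof -
      have "- real (k l) * (T l / 4)\<^sup>2 / (16 * b\<^sup>2) \<le> - (real 12 * ln b)"
      proof -
        have "H l * (T l)\<^sup>2 = 3072 * b\<^sup>2 * ln b" using T0'[of l] by (simp add: H_def)
        moreover have "H l * (T l)\<^sup>2 \<le> real (k l) * (T l)\<^sup>2" by (intro mult_right_mono kH) auto
        ultimately have "3072 * b\<^sup>2 * ln b \<le> real (k l) * (T l)\<^sup>2" by simp
        then show ?thesis using b by (simp add: field_simps power2_eq_square)
      qed
      then have "e \<le> 4 * exp (- (real 12 * ln b))" unfolding e_def by simp
      also have "\<dots> = 4 / b ^ 12"
        unfolding exp_minus exp_of_nat_mult using b by (simp add: inverse_eq_divide)
      also have "\<dots> \<le> 3 / (256 * b ^ 3)"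
      proof -
        have "(2::real) ^ 9 \<le> b ^ 9" using b by (intro power_mono) auto
        then have "1024 * b ^ 3 \<le> 3 * b ^ 9 * b ^ 3" using b by (intro mult_right_mono) auto
        also have "\<dots> = 3 * b ^ 12" by (simp flip: power_add)
        finally show ?thesis using b by (simp add: field_simps)
      qed
      also have "\<dots> \<le> a l / 4"
      proof -
        have "real \<Lambda> * (T l)\<^sup>2 \<le> (4 * b) * b\<^sup>2" using \<Lambda>4b T2b[OF l] b by (intro mult_mono) auto
        then have "64 * (real \<Lambda> * (T l)\<^sup>2) \<le> 256 * b ^ 3" by (simp add: power2_eq_square power3_eq_cube)
        then have "3 / (256 * b ^ 3) \<le> 3 / (64 * (real \<Lambda> * (T l)\<^sup>2))"
          using \<Lambda>0 T0'[of l] b by (intro divide_left_mono) auto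
        then show ?thesis by (simp add: a_def mult.assoc)
      qed
      finally show ?thesis .
    qed
    obtain ks where ks: "length ks = k l" "set ks \<subseteq> I" and
      pb: "prob {y \<in> space M. T l / 4 \<le> \<bar>G l ks y - F y\<bar>} \<le> e" and
      mb: "(\<Sum>j<m. of_bool (T l / 4 \<le> \<bar>G l ks (x j) - F (x j)\<bar>)) \<le> e * real m"
      using maurey[of I p \<psi> b m x "k l" "T l / 4", OF finI p0 p1 \<psi>m \<psi>b _ _ k0[OF l]] b x T0'[of l]
      unfolding F_alt G_def e_def by auto
    have "a l \<le> prob (U l ks \<union> {y \<in> space M. T l / 4 \<le> \<bar>G l ks y - F y\<bar>})"
    proof (rule order_trans[OF lev], rule finite_measure_mono)
      show "{y \<in> space M. T l \<le> \<bar>F y\<bar>} \<subseteq> U l ks \<union> {y \<in> space M. T l / 4 \<le> \<bar>G l ks y - F y\<bar>}"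
      proof
        fix y assume y: "y \<in> {y \<in> space M. T l \<le> \<bar>F y\<bar>}"
        then have "T l \<le> \<bar>F y\<bar>" by simp
        then have "T l / 4 \<le> \<bar>G l ks y - F y\<bar> \<or> 3/4 * T l \<le> \<bar>G l ks y\<bar>" by linarith
        with y show "y \<in> U l ks \<union> {y \<in> space M. T l / 4 \<le> \<bar>G l ks y - F y\<bar>}"
          unfolding U_def by blast
      qed
      show "U l ks \<union> {y \<in> space M. T l / 4 \<le> \<bar>G l ks y - F y\<bar>} \<in> sets M"
        using Um[OF ks(2), of l] Gm[OF ks(2), of l] Fm by measurable
    qed
    also have "\<dots> \<le> prob (U l ks) + prob {y \<in> space M. T l / 4 \<le> \<bar>G l ks y - F y\<bar>}"
    proof (rule measure_Un_le[OF Um[OF ks(2)]])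
      show "{y \<in> space M. T l / 4 \<le> \<bar>G l ks y - F y\<bar>} \<in> sets M"
        using Gm[OF ks(2), of l] Fm by measurable
    qed
    finally have "3/4 * a l \<le> prob (U l ks)" using pb e by linarith
    then have "(l, ks) \<in> X" using l ks by (auto simp: X_def L_def)
    then have "3/4 * a l * real m / 2 \<le> (\<Sum>j<m. indicat_real (U l ks) (x j))" using cnt by force
    moreover have "e * real m < 3/4 * a l * real m / 2"
    proof -
      have "e * real m \<le> a l / 4 * real m" using e by (intro mult_right_mono) auto
      moreover have "a l * real m > 0" using a0 m0 by simp
      ultimately show ?thesis by simp
    qed
    ultimately have lt: "(\<Sum>j<m. of_bool (T l / 4 \<le> \<bar>G l ks (x j) - F (x j)\<bar>)) < (\<Sum>j<m. indicat_real (U l ks) (x j))"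
      using mb by linarith
    have "\<exists>j<m. x j \<in> U l ks \<and> \<not> T l / 4 \<le> \<bar>G l ks (x j) - F (x j)\<bar>"
    proof (rule ccontr)
      assume "\<not> ?thesis"
      then have "(\<Sum>j<m. indicat_real (U l ks) (x j)) \<le> (\<Sum>j<m. of_bool (T l / 4 \<le> \<bar>G l ks (x j) - F (x j)\<bar>))"
        by (intro sum_mono) (auto simp: indicator_def)
      with lt show False by simp
    qed
    then obtain j where j: "j < m" "x j \<in> U l ks" "\<not> T l / 4 \<le> \<bar>G l ks (x j) - F (x j)\<bar>" by blast
    then have "3/4 * T l \<le> \<bar>G l ks (x j)\<bar>" "\<bar>G l ks (x j) - F (x j)\<bar> < T l / 4" by (auto simp: U_def)
    then have "1/4 \<le> \<bar>F (x j)\<bar>" using T0[of l] by linarith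
    then show ?thesis using j(1) unfolding F_def by blast
  qed
  with x show ?thesis by blast
qed

section \<open>Sparse recovery\<close>

lemma sum_abs_le_powr:
  fixes c :: "'i \<Rightarrow> real"
  assumes "0 < q" "q < 1" "\<And>k. k \<in> J \<Longrightarrow> \<bar>c k\<bar> \<le> \<theta>"
  shows "(\<Sum>k\<in>J. \<bar>c k\<bar>) \<le> \<theta> powr (1 - q) * (\<Sum>k\<in>J. \<bar>c k\<bar> powr q)"
  unfolding sum_distrib_left
proof (rule sum_mono)
  fix k assume k: "k \<in> J"
  have "\<bar>c k\<bar> = \<bar>c k\<bar> powr ((1 - q) + q)" by simp
  also have "\<dots> = \<bar>c k\<bar> powr (1 - q) * \<bar>c k\<bar> powr q" by (rule powr_add)
  also have "\<dots> \<le> \<theta> powr (1 - q) * \<bar>c k\<bar> powr q"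
    using assms(2) assms(3)[OF k] by (intro mult_right_mono powr_mono2) auto
  finally show "\<bar>c k\<bar> \<le> \<theta> powr (1 - q) * \<bar>c k\<bar> powr q" .
qed

text \<open>Each entry is at most \<open>Z powr (1 / q)\<close>; used as the threshold in
  \<open>sum_abs_le_powr\<close> this yields the exponent
  \<open>(1 - q) / q + 1 = 1 / q\<close>.\<close>

lemma sum_abs_le_quasinorm:
  fixes c :: "'i \<Rightarrow> real"
  assumes "finite J" "0 < q" "q < 1" "(\<Sum>k\<in>J. \<bar>c k\<bar> powr q) \<le> Z"
  shows "(\<Sum>k\<in>J. \<bar>c k\<bar>) \<le> Z powr (1 / q)"
proof -
  have Z: "Z \<ge> 0" using assms(4) by (meson order_trans powr_ge_zero sum_nonneg)
  have "\<bar>c k\<bar> \<le> Z powr (1 / q)" if "k \<in> J" for k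
  proof -
    have "\<bar>c k\<bar> powr q \<le> (\<Sum>k\<in>J. \<bar>c k\<bar> powr q)" using that assms(1) by (intro member_le_sum) auto
    then have "(\<bar>c k\<bar> powr q) powr (1 / q) \<le> Z powr (1 / q)"
      using assms by (intro powr_mono2) auto
    then show ?thesis using assms by (simp add: powr_powr)
  qed
  then have "(\<Sum>k\<in>J. \<bar>c k\<bar>) \<le> (Z powr (1 / q)) powr (1 - q) * (\<Sum>k\<in>J. \<bar>c k\<bar> powr q)"
    using assms by (intro sum_abs_le_powr)
  also have "\<dots> \<le> (Z powr (1 / q)) powr (1 - q) * Z" using assms by (intro mult_left_mono) auto
  also have "\<dots> = Z powr (1 / q)"
  proof (cases "Z = 0")
    case False
    then have "(Z powr (1 / q)) powr (1 - q) * Z = Z powr (1 / q * (1 - q) + 1)"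
      using Z by (simp add: powr_powr powr_add)
    also have "1 / q * (1 - q) + 1 = 1 / q" using assms by (simp add: field_simps)
    finally show ?thesis .
  qed simp
  finally show ?thesis .
qed

text \<open>Stechkin's estimate by thresholding: at most \<open>s\<close> entries exceed
  \<open>\<theta> = (Z / s) powr (1 / q)\<close>, and by \<open>sum_abs_le_powr\<close> the others
  sum to at most \<open>\<theta> powr (1 - q) * Z\<close>.\<close>

lemma best_term_approximation:
  fixes c :: "'i \<Rightarrow> real" and s :: nat
  assumes "finite J" "0 < q" "q < 1" "s \<ge> 1" "(\<Sum>k\<in>J. \<bar>c k\<bar> powr q) \<le> Z"
  shows "\<exists>S\<subseteq>J. card S \<le> s \<and> (\<Sum>k\<in>J - S. \<bar>c k\<bar>) \<le> real s powr (1 - 1 / q) * Z powr (1 / q)"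
proof (cases "Z > 0")
  case False
  then have "(\<Sum>k\<in>J. \<bar>c k\<bar> powr q) \<le> 0" using assms by simp
  then have "(\<Sum>k\<in>J. \<bar>c k\<bar>) \<le> 0 powr (1 / q)" using assms by (intro sum_abs_le_quasinorm) auto
  then have "(\<Sum>k\<in>J. \<bar>c k\<bar>) \<le> 0" by simp
  then have "(\<Sum>k\<in>J - {}. \<bar>c k\<bar>) \<le> real s powr (1 - 1 / q) * Z powr (1 / q)"
    by (simp add: order_trans)
  then show ?thesis by (intro exI[of _ "{}"]) auto
next
  case True
  define \<theta> where "\<theta> = (Z / real s) powr (1 / q)"
  have \<theta>: "\<theta> > 0" using True assms by (simp add: \<theta>_def)
  have \<theta>q: "\<theta> powr q = Z / real s" using True assms by (simp add: \<theta>_def powr_powr)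
  define S where "S = {k \<in> J. \<theta> < \<bar>c k\<bar>}"
  have "real (card S) * (Z / real s) = (\<Sum>k\<in>S. \<theta> powr q)" by (simp add: \<theta>q)
  also have "\<dots> \<le> (\<Sum>k\<in>S. \<bar>c k\<bar> powr q)"
    using \<theta> assms by (intro sum_mono powr_mono2) (auto simp: S_def)
  also have "\<dots> \<le> (\<Sum>k\<in>J. \<bar>c k\<bar> powr q)" using assms by (intro sum_mono2) (auto simp: S_def)
  also have "\<dots> \<le> Z" by fact
  finally have "real (card S) \<le> real s" using True assms by (simp add: field_simps)
  moreover have "(\<Sum>k\<in>J - S. \<bar>c k\<bar>) \<le> real s powr (1 - 1 / q) * Z powr (1 / q)"
  proof -
    have "(\<Sum>k\<in>J - S. \<bar>c k\<bar>) \<le> \<theta> powr (1 - q) * (\<Sum>k\<in>J - S. \<bar>c k\<bar> powr q)"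
      using assms by (intro sum_abs_le_powr) (auto simp: S_def)
    also have "\<dots> \<le> \<theta> powr (1 - q) * Z"
    proof (intro mult_left_mono order_trans[OF _ assms(5)] sum_mono2)
    qed (use assms in auto)
    also have "\<dots> = (Z / real s) powr (1 / q * (1 - q)) * Z" by (simp add: \<theta>_def powr_powr)
    also have "1 / q * (1 - q) = 1 / q - 1" using assms by (simp add: field_simps)
    also have "(Z / real s) powr (1 / q - 1) * Z = Z powr (1 / q - 1) * Z / real s powr (1 / q - 1)"
      using True by (simp add: powr_divide)
    also have "Z powr (1 / q - 1) * Z = Z powr (1 / q)" using True by (simp add: powr_diff)
    also have "Z powr (1 / q) / real s powr (1 / q - 1) = real s powr (1 - 1 / q) * Z powr (1 / q)"
    proof -
      have "real s powr (1 - 1 / q) = inverse (real s powr (1 / q - 1))"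
        by (simp flip: powr_minus)
      then show ?thesis by (simp add: divide_inverse)
    qed
    finally show ?thesis .
  qed
  ultimately show ?thesis by (intro exI[of _ S]) (auto simp: S_def)
qed

text \<open>Here \<open>r\<close> stands for the penalised residual at the sampling points. Let
  \<open>D\<close> and \<open>n\<close> be the \<open>l1\<close> and \<open>l2\<close> norms of
  \<open>c - c'\<close>. Comparing on and off \<open>S\<close> bounds \<open>D + r\<close> by
  \<open>2 * sqrt s * n\<close> plus half the claimed bound. Either
  \<open>D > 4 * sqrt s * n\<close>, and the first term is below \<open>D / 2\<close>, or
  \<open>alt\<close> lets \<open>r\<close> absorb it.\<close>

lemma l1_decoding_error:
  fixes c c' :: "'i \<Rightarrow> real" and s :: nat
  assumes J: "finite J" "S \<subseteq> J" "card S \<le> s" and r: "r \<ge> 0"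
    and h: "(\<Sum>k\<in>J. \<bar>c' k\<bar>) + r \<le> (\<Sum>k\<in>J. \<bar>c k\<bar>) + B"
    and alt: "(\<Sum>k\<in>J. \<bar>c k - c' k\<bar>) \<le> 4 * sqrt (real s) * L2_set (\<lambda>k. c k - c' k) J \<Longrightarrow>
       2 * sqrt (real s) * L2_set (\<lambda>k. c k - c' k) J \<le> r"
  shows "(\<Sum>k\<in>J. \<bar>c k - c' k\<bar>) \<le> 2 * (2 * (\<Sum>k\<in>J - S. \<bar>c k\<bar>) + B)"
proof -
  define d where "d k = c k - c' k" for k
  define D where "D = (\<Sum>k\<in>J. \<bar>d k\<bar>)"
  have fS: "finite S" using J finite_subset by blast
  have "(\<Sum>k\<in>J. \<bar>c' k\<bar>) = (\<Sum>k\<in>J - S. \<bar>c' k\<bar>) + (\<Sum>k\<in>S. \<bar>c' k\<bar>)" using J by (metis sum.subset_diff)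
  moreover have "(\<Sum>k\<in>J. \<bar>c k\<bar>) = (\<Sum>k\<in>J - S. \<bar>c k\<bar>) + (\<Sum>k\<in>S. \<bar>c k\<bar>)" using J by (metis sum.subset_diff)
  moreover have D: "D = (\<Sum>k\<in>J - S. \<bar>d k\<bar>) + (\<Sum>k\<in>S. \<bar>d k\<bar>)"
    unfolding D_def using J by (metis sum.subset_diff)
  moreover have "(\<Sum>k\<in>S. \<bar>c k\<bar>) - (\<Sum>k\<in>S. \<bar>d k\<bar>) \<le> (\<Sum>k\<in>S. \<bar>c' k\<bar>)"
    unfolding sum_subtractf[symmetric] by (intro sum_mono) (auto simp: d_def)
  moreover have "(\<Sum>k\<in>J - S. \<bar>d k\<bar>) - (\<Sum>k\<in>J - S. \<bar>c k\<bar>) \<le> (\<Sum>k\<in>J - S. \<bar>c' k\<bar>)"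
    unfolding sum_subtractf[symmetric] by (intro sum_mono) (auto simp: d_def)
  ultimately have main: "D + r \<le> 2 * (\<Sum>k\<in>S. \<bar>d k\<bar>) + (2 * (\<Sum>k\<in>J - S. \<bar>c k\<bar>) + B)"
    using h by linarith
  have dS: "(\<Sum>k\<in>S. \<bar>d k\<bar>) \<le> sqrt (real s) * L2_set d J"
  proof -
    have "(\<Sum>k\<in>S. \<bar>d k\<bar>) = (\<Sum>k\<in>S. \<bar>1\<bar> * \<bar>d k\<bar>)" by simp
    also have "\<dots> \<le> L2_set (\<lambda>_. 1) S * L2_set d S" by (rule L2_set_mult_ineq)
    also have "L2_set (\<lambda>_. 1) S = sqrt (real (card S))" by (simp add: L2_set_def)
    also have "sqrt (real (card S)) * L2_set d S \<le> sqrt (real s) * L2_set d J"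
      using J by (intro mult_mono) (auto simp: L2_set_def intro!: real_sqrt_le_mono sum_mono2 sum_nonneg)
    finally show ?thesis .
  qed
  have D0: "D \<ge> 0" by (simp add: D_def sum_nonneg)
  have arith: "D \<le> 2 * W" if "2 * y \<le> r" "D + r \<le> 2 * x + W" "x \<le> y" for x y W
    using that D0 by linarith
  have arith': "D \<le> 2 * W" if "\<not> D \<le> 4 * y" "D + r \<le> 2 * x + W" "x \<le> y" for x y W
    using that r by linarith
  have "D \<le> 2 * (2 * (\<Sum>k\<in>J - S. \<bar>c k\<bar>) + B)"
  proof (cases "D \<le> 4 * (sqrt (real s) * L2_set d J)")
    case True
    then have "2 * (sqrt (real s) * L2_set d J) \<le> r" using alt unfolding D_def d_def by (simp add: mult.assoc)
    then show ?thesis using main dS by (rule arith)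
  next
    case False
    then show ?thesis using main dS by (rule arith')
  qed
  then show ?thesis by (simp add: D_def d_def)
qed

text \<open>A relative slack is effective only above a positive infimum; comparability with
  \<open>z\<close> ensures this, unless \<open>obj z = 0\<close> and \<open>z\<close> is itself
  minimal. It stands in for a compactness argument giving an exact minimiser.\<close>

lemma exists_near_minimizer:
  fixes obj :: "'b \<Rightarrow> real"
  assumes "\<And>c. obj c \<ge> 0" "\<And>c. obj z \<le> K * obj c" "K > 0" "\<epsilon> > 0"
  shows "\<exists>c'. \<forall>c. obj c' \<le> (1 + \<epsilon>) * obj c"
proof (cases "obj z = 0")
  case True
  then show ?thesis using assms by (intro exI[of _ z]) auto
next
  case False
  define i where "i = Inf (range obj)"
  have bdd: "bdd_below (range obj)" using assms(1) by (auto intro!: bdd_belowI[of _ 0])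
  have "obj z / K \<le> i" unfolding i_def
    using assms(2,3) by (intro cInf_greatest) (auto simp: field_simps)
  moreover have "obj z / K > 0" using False assms(1)[of z] assms(3) by simp
  ultimately have "i > 0" by linarith
  then have "i < (1 + \<epsilon>) * i" using assms(4) by simp
  then obtain c' where "obj c' < (1 + \<epsilon>) * i"
    using cInf_lessD[of "range obj" "(1 + \<epsilon>) * i"] unfolding i_def by auto
  moreover have "i \<le> obj c" for c unfolding i_def using bdd by (intro cInf_lower) auto
  then have "(1 + \<epsilon>) * i \<le> (1 + \<epsilon>) * obj c" for c using assms(4) by (intro mult_left_mono) auto
  ultimately show ?thesis by (metis less_eq_real_def order_trans)
qed

section \<open>Sampling and decoding Legendre expansions\<close>

lemma flcoeff_diff_legendre_sum:
  assumes f: "continuous_on {-1..1} f" and sm: "summable (\<lambda>k. \<bar>flcoeff f k\<bar>)"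
  shows "summable (\<lambda>k. \<bar>flcoeff (\<lambda>x. f x - poly (legendre_sum a N) x) k\<bar>)"
    and "(\<Sum>k. \<bar>flcoeff (\<lambda>x. f x - poly (legendre_sum a N) x) k\<bar>) =
      (\<Sum>k\<le>N. \<bar>flcoeff f k - a k\<bar>) + (\<Sum>k. \<bar>flcoeff f (k + Suc N)\<bar>)"
proof -
  define u where "u k = \<bar>flcoeff (\<lambda>x. f x - poly (legendre_sum a N) x) k\<bar>" for k
  have u: "u k = \<bar>flcoeff f k - (if k \<le> N then a k else 0)\<bar>" for k
    unfolding u_def by (subst flcoeff_diff) (auto intro!: continuous_intros f simp: flcoeff_legendre_sum)
  have shift: "(\<lambda>k. u (k + Suc N)) = (\<lambda>k. \<bar>flcoeff f (k + Suc N)\<bar>)" by (auto simp: u)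
  have "summable (\<lambda>k. u (k + Suc N))"
    unfolding shift using summable_ignore_initial_segment[OF sm] .
  then show *: "summable (\<lambda>k. \<bar>flcoeff (\<lambda>x. f x - poly (legendre_sum a N) x) k\<bar>)"
    unfolding u_def[symmetric] by (subst (asm) summable_iff_shift)
  have "suminf u = (\<Sum>k. u (k + Suc N)) + (\<Sum>k<Suc N. u k)"
    using * unfolding u_def[symmetric] by (rule suminf_split_initial_segment)
  also have "(\<Sum>k<Suc N. u k) = (\<Sum>k\<le>N. \<bar>flcoeff f k - a k\<bar>)"
    unfolding lessThan_Suc_atMost by (intro sum.cong) (auto simp: u)
  finally show "(\<Sum>k. \<bar>flcoeff (\<lambda>x. f x - poly (legendre_sum a N) x) k\<bar>) =
      (\<Sum>k\<le>N. \<bar>flcoeff f k - a k\<bar>) + (\<Sum>k. \<bar>flcoeff f (k + Suc N)\<bar>)"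
    unfolding shift unfolding u_def by (simp only: add.commute)
qed

lemma A1w_space_summable:
  assumes "f \<in> A1w_space \<alpha>" "\<alpha> > 0"
  shows "continuous_on {-1..1} f" "summable (\<lambda>k. \<bar>flcoeff f k\<bar>)"
    "summable (\<lambda>k. (1 + real k) powr \<alpha> * \<bar>flcoeff f k\<bar>)"
proof -
  show *: "continuous_on {-1..1} f" "summable (\<lambda>k. (1 + real k) powr \<alpha> * \<bar>flcoeff f k\<bar>)"
    using assms by (auto simp: A1w_space_def)
  have "\<bar>flcoeff f k\<bar> \<le> (1 + real k) powr \<alpha> * \<bar>flcoeff f k\<bar>" for k
    using mult_right_mono[of 1 "(1 + real k) powr \<alpha>" "\<bar>flcoeff f k\<bar>"] assms(2)
    by (simp add: ge_one_powr_ge_zero)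
  then show "summable (\<lambda>k. \<bar>flcoeff f k\<bar>)"
    by (intro summable_comparison_test'[OF *(2)]) auto
qed

text \<open>The first index of the tail is N + 1, where the weight is
  \<open>(N + 2) powr \<alpha>\<close>. The resulting shift by 2 admits even a constant
  reconstruction when \<open>s powr (\<gamma> / \<alpha>) \<le> 2\<close>.\<close>

lemma coeff_tail_le:
  assumes f: "f \<in> A1w_space \<alpha>" and \<alpha>: "\<alpha> > 0" and s: "s \<ge> 1"
    and N: "real s powr (\<gamma> / \<alpha>) \<le> real N + 2"
  shows "real s powr \<gamma> * (\<Sum>k. \<bar>flcoeff f (k + Suc N)\<bar>) \<le> A1w_norm \<alpha> f"
proof -
  note sm = A1w_space_summable[OF f \<alpha>]
  define h where "h k = (1 + real k) powr \<alpha> * \<bar>flcoeff f k\<bar>" for k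
  have smh: "summable (\<lambda>k. h (k + Suc N))"
    using summable_ignore_initial_segment[OF sm(3)] unfolding h_def .
  have "(real s powr (\<gamma> / \<alpha>)) powr \<alpha> \<le> (real N + 2) powr \<alpha>"
    using N \<alpha> by (intro powr_mono2) auto
  then have *: "real s powr \<gamma> \<le> (real N + 2) powr \<alpha>" using \<alpha> by (simp add: powr_powr)
  have "real s powr \<gamma> * (\<Sum>k. \<bar>flcoeff f (k + Suc N)\<bar>) = (\<Sum>k. real s powr \<gamma> * \<bar>flcoeff f (k + Suc N)\<bar>)"
    by (rule suminf_mult[symmetric]) (rule summable_ignore_initial_segment[OF sm(2)])
  also have "\<dots> \<le> (\<Sum>k. h (k + Suc N))"
  proof (intro suminf_le smh summable_mult summable_ignore_initial_segment[OF sm(2)])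
    fix k
    have "(real N + 2) powr \<alpha> \<le> (1 + real (k + Suc N)) powr \<alpha>" using \<alpha> by (intro powr_mono2) auto
    then show "real s powr \<gamma> * \<bar>flcoeff f (k + Suc N)\<bar> \<le> h (k + Suc N)"
      unfolding h_def using * by (intro mult_right_mono) auto
  qed
  also have "\<dots> \<le> (\<Sum>k. h (k + Suc N)) + (\<Sum>k<Suc N. h k)"
    by (simp add: h_def sum_nonneg del: sum.lessThan_Suc)
  also have "\<dots> = suminf h"
    using sm(3) unfolding h_def[symmetric] by (rule suminf_split_initial_segment[symmetric])
  finally show ?thesis unfolding A1w_norm_def h_def .
qed

lemma A_space_partial_sum:
  assumes "f \<in> A_space q" "finite J"
  shows "(\<Sum>k\<in>J. \<bar>flcoeff f k\<bar> powr q) \<le> (\<Sum>k. \<bar>flcoeff f k\<bar> powr q)"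
  using assms by (intro sum_le_suminf) (auto simp: A_space_def)

text \<open>The decoder nearly minimises \<open>\<parallel>c\<parallel>\<^sub>1 + 16 \<surd>s \<parallel>y - F c\<parallel>\<^sub>\<infinity>\<close> with relative slack \<open>s\<^sup>1\<^sup>-\<^sup>1\<^sup>/\<^sup>q\<close>; unlike
  constrained \<open>l\<^sub>1\<close>-minimisation this needs no bound on the noise, which here is the tail of \<open>f\<close>.\<close>

lemma legendre_decoder:
  fixes xs :: "real list" and N s :: nat and q \<alpha> :: real
  assumes q: "0 < q" "q < 1" and \<alpha>: "\<alpha> > 0" and s: "s \<ge> 1" and xs: "set xs \<subseteq> {-1..1}"
    and low: "\<And>c. (\<Sum>k\<le>N. \<bar>c k\<bar>) \<le> 4 * sqrt (real s) * L2_set c {..N} \<Longrightarrow>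
       \<exists>x\<in>set xs. L2_set c {..N} / 8 \<le> \<bar>\<Sum>k\<le>N. c k * (wgt x * legendreL k x)\<bar>"
    and N: "real s powr ((1/q - 1/2) / \<alpha>) \<le> real N + 2"
  shows "\<exists>R. (\<forall>v. degree (R v) \<le> N) \<and>
    (\<forall>f\<in>A_space q \<inter> A1w_space \<alpha>. A_norm 1 (\<lambda>x. f x - poly (R (map f xs)) x)
        \<le> 200 * (A_norm q f + A1w_norm \<alpha> f) * real s powr (1 - 1/q))"
proof -
  define F where "F c x = (\<Sum>k\<le>N. c k * (wgt x * legendreL k x))" for c x
  define l1 where "l1 c = (\<Sum>k\<le>N. \<bar>c k\<bar>)" for c :: "nat \<Rightarrow> real"
  \<comment> \<open>\<open>insert 0\<close> keeps the maximum meaningful for an empty list of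
    points.\<close>
  define E where "E v c = Max (insert 0 ((\<lambda>j. \<bar>wgt (xs ! j) * v ! j - F c (xs ! j)\<bar>) ` {..<length xs}))"
    for v c
  \<comment> \<open>The factor 16 turns the lower bound \<open>L2_set d {..N} / 8\<close> at some
    point into the residual \<open>2 * sqrt s * L2_set d {..N}\<close> that
    \<open>l1_decoding_error\<close> requires.\<close>
  define obj where "obj v c = l1 c + 16 * sqrt (real s) * E v c" for v c
  define \<epsilon> where "\<epsilon> = real s powr (1 - 1/q)"
  have \<epsilon>0: "\<epsilon> > 0" using s by (simp add: \<epsilon>_def)
  have \<epsilon>1: "\<epsilon> \<le> 1"
  proof -
    have "real s powr (1 - 1/q) \<le> real s powr 0" using s q by (intro powr_mono) (auto simp: field_simps)
    then show ?thesis using s by (simp add: \<epsilon>_def)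
  qed
  have s1: "sqrt (real s) \<ge> 1" using s by simp
  have sqrt3: "sqrt 3 \<le> (2::real)" by (rule real_le_lsqrt) auto
  have E0: "E v c \<ge> 0" for v c unfolding E_def by (rule Max_ge) auto
  have E_ge: "\<bar>wgt (xs ! j) * v ! j - F c (xs ! j)\<bar> \<le> E v c" if "j < length xs" for v c j
    unfolding E_def using that by (intro Max_ge) auto
  have E_le: "E v c \<le> B" if "B \<ge> 0" "\<And>j. j < length xs \<Longrightarrow> \<bar>wgt (xs ! j) * v ! j - F c (xs ! j)\<bar> \<le> B" for v c B
    unfolding E_def using that by (subst Max_le_iff) auto
  have l1_0: "l1 c \<ge> 0" for c by (simp add: l1_def sum_nonneg)
  have xj: "xs ! j \<in> {-1..1}" if "j < length xs" for j using xs that nth_mem by blast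
  have F_le: "\<bar>F c x\<bar> \<le> 2 * l1 c" if "x \<in> {-1..1}" for c x
  proof -
    have "\<bar>F c x\<bar> \<le> (\<Sum>k\<le>N. \<bar>c k * (wgt x * legendreL k x)\<bar>)" unfolding F_def by (rule sum_abs)
    also have "\<dots> \<le> (\<Sum>k\<le>N. \<bar>c k\<bar> * 2)"
    proof -
      have "\<bar>wgt x * legendreL k x\<bar> \<le> 2" for k
        using that by (intro order_trans[OF wgt_legendreL_le sqrt3]) auto
      then show ?thesis unfolding abs_mult[of "c _"] by (intro sum_mono mult_left_mono) auto
    qed
    finally show ?thesis by (simp add: l1_def sum_distrib_left mult.commute)
  qed
  have "\<exists>c'. \<forall>c. obj v c' \<le> (1 + \<epsilon>) * obj v c" for v
  \<comment> \<open>The zero vector is comparable with every \<open>c\<close>: replacing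
    \<open>c\<close> by 0 raises the misfit by at most \<open>2 * l1 c\<close>.\<close>
  proof (rule exists_near_minimizer[where z = "\<lambda>_. 0" and K = "1 + 32 * sqrt (real s)"])
    show "obj v c \<ge> 0" for c unfolding obj_def using l1_0 E0 by (intro add_nonneg_nonneg mult_nonneg_nonneg) auto
    show "obj v (\<lambda>_. 0) \<le> (1 + 32 * sqrt (real s)) * obj v c" for c
    proof -
      have "E v (\<lambda>_. 0) \<le> E v c + 2 * l1 c"
      proof (rule E_le)
        fix j assume j: "j < length xs"
        have "F (\<lambda>_. 0) (xs ! j) = 0" by (simp add: F_def)
        then show "\<bar>wgt (xs ! j) * v ! j - F (\<lambda>_. 0) (xs ! j)\<bar> \<le> E v c + 2 * l1 c"
          using E_ge[OF j, of v c] F_le[OF xj[OF j], of c] by linarith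
      qed (use E0[of v c] l1_0[of c] in linarith)
      then have "16 * sqrt (real s) * E v (\<lambda>_. 0) \<le> 16 * sqrt (real s) * (E v c + 2 * l1 c)"
        by (intro mult_left_mono) auto
      also have "\<dots> = 16 * sqrt (real s) * E v c + 32 * sqrt (real s) * l1 c" by (simp add: algebra_simps)
      also have "\<dots> \<le> (1 + 32 * sqrt (real s)) * obj v c"
      proof -
        have "0 \<le> l1 c" "0 \<le> 32 * sqrt (real s) * (16 * sqrt (real s) * E v c)"
          using l1_0 E0 by auto
        then show ?thesis by (simp add: obj_def algebra_simps)
      qed
      finally show ?thesis by (simp add: obj_def l1_def)
    qed
    show "1 + 32 * sqrt (real s) > 0" using s1 by linarith
  qed (rule \<epsilon>0)
  then obtain dec where dec: "\<And>v c. obj v (dec v) \<le> (1 + \<epsilon>) * obj v c" by metis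
  define R where "R v = legendre_sum (dec v) N" for v
  have "A_norm 1 (\<lambda>x. f x - poly (R (map f xs)) x)
        \<le> 200 * (A_norm q f + A1w_norm \<alpha> f) * real s powr (1 - 1/q)"
    if f: "f \<in> A_space q" "f \<in> A1w_space \<alpha>" for f
  proof -
    note sm = A1w_space_summable[OF f(2) \<alpha>]
    define c where "c = flcoeff f"
    define v where "v = map f xs"
    define c' where "c' = dec v"
    define t where "t = (\<Sum>k. \<bar>c (k + Suc N)\<bar>)"
    define Q where "Q = A_norm q f"
    define W where "W = A1w_norm \<alpha> f"
    define Z where "Z = (\<Sum>k. \<bar>c k\<bar> powr q)"
    have QZ: "Q = Z powr (1 / q)" by (simp add: Q_def A_norm_def Z_def c_def)
    have Z: "(\<Sum>k\<le>N. \<bar>c k\<bar> powr q) \<le> Z"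
      unfolding Z_def c_def by (rule A_space_partial_sum[OF f(1)]) simp
    have t0: "t \<ge> 0" unfolding t_def c_def
      by (intro suminf_nonneg summable_ignore_initial_segment[OF sm(2)]) auto
    \<comment> \<open>The exponents 1 - 1/q and 1/q - 1/2 add up to 1/2, which is what fixes the
      size of \<open>N\<close>.\<close>
    have tW: "sqrt (real s) * t \<le> \<epsilon> * W"
    proof -
      have "real s powr (1/q - 1/2) * t \<le> W"
        unfolding t_def c_def W_def by (rule coeff_tail_le[OF f(2) \<alpha> s N])
      then have "\<epsilon> * (real s powr (1/q - 1/2) * t) \<le> \<epsilon> * W" using \<epsilon>0 by (intro mult_left_mono) auto
      moreover have "\<epsilon> * real s powr (1/q - 1/2) = sqrt (real s)"
        using s by (simp add: \<epsilon>_def powr_half_sqrt flip: powr_add)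
      ultimately show ?thesis by (simp add: mult.assoc[symmetric])
    qed
    have l1Q: "l1 c \<le> Q" unfolding l1_def QZ using q Z by (intro sum_abs_le_quasinorm) auto
    obtain S where S: "S \<subseteq> {..N}" "card S \<le> s" "(\<Sum>k\<in>{..N} - S. \<bar>c k\<bar>) \<le> \<epsilon> * Q"
      using best_term_approximation[OF _ q s Z] unfolding QZ \<epsilon>_def by auto
    have noise: "\<bar>wgt x * f x - F c x\<bar> \<le> 2 * t" if x: "x \<in> {-1..1}" for x
    proof -
      let ?g = "\<lambda>x. f x - poly (legendre_sum c N) x"
      have "\<bar>?g x\<bar> * wgt x \<le> sqrt 3 * (\<Sum>k. \<bar>flcoeff ?g k\<bar>)"
        by (intro wgt_mult_le_coeff_sum flcoeff_diff_legendre_sum continuous_intros sm x)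
      also have "(\<Sum>k. \<bar>flcoeff ?g k\<bar>) = t"
        using flcoeff_diff_legendre_sum(2)[OF sm(1,2), of c N] by (simp add: t_def c_def)
      also have "sqrt 3 * t \<le> 2 * t" using sqrt3 t0 by (intro mult_right_mono)
      finally have "\<bar>?g x * wgt x\<bar> \<le> 2 * t" by (simp add: abs_mult)
      moreover have "?g x * wgt x = wgt x * f x - F c x"
        unfolding poly_legendre_sum F_def by (simp add: algebra_simps sum_distrib_left)
      ultimately show ?thesis by simp
    qed
    have Ec: "E v c \<le> 2 * t"
      using noise[OF xj] t0 by (intro E_le) (auto simp: v_def)
    define d where "d k = c k - c' k" for k
    define r where "r = 16 * sqrt (real s) * Max (insert 0 ((\<lambda>x. \<bar>F d x\<bar>) ` set xs))"
    have Fd: "F d x = F c x - F c' x" for x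
      by (simp add: F_def d_def left_diff_distrib sum_subtractf)
    have MaxE: "Max (insert 0 ((\<lambda>x. \<bar>F d x\<bar>) ` set xs)) \<le> E v c' + 2 * t"
    proof -
      have "\<bar>F d x\<bar> \<le> E v c' + 2 * t" if x: "x \<in> set xs" for x
      proof -
        obtain j where j: "j < length xs" "x = xs ! j" using x unfolding in_set_conv_nth by blast
        have "\<bar>wgt x * f x - F c' x\<bar> \<le> E v c'" using E_ge[OF j(1), of v c'] j by (simp add: v_def)
        then show ?thesis using noise[OF xj[OF j(1)]] unfolding Fd j(2) by linarith
      qed
      moreover have "0 \<le> E v c' + 2 * t" using E0[of v c'] t0 by linarith
      ultimately show ?thesis by (subst Max_le_iff) auto
    qed
    have objc: "obj v c \<le> l1 c + 32 * (sqrt (real s) * t)"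
    proof -
      have "16 * sqrt (real s) * E v c \<le> 16 * sqrt (real s) * (2 * t)" using Ec by (intro mult_left_mono) auto
      then show ?thesis by (simp add: obj_def)
    qed
    \<comment> \<open>96 = 32 + 64: replacing the data by \<open>F c\<close> in the residual costs
      32, and near-minimality compares with \<open>obj v c\<close>, whose noise part 32 is at most
      doubled since \<open>1 + \<epsilon> \<le> 2\<close>.\<close>
    have h: "l1 c' + r \<le> l1 c + (\<epsilon> * l1 c + 96 * (sqrt (real s) * t))"
    proof -
      have "l1 c' + r \<le> obj v c' + 32 * (sqrt (real s) * t)"
      proof -
        have "r \<le> 16 * sqrt (real s) * (E v c' + 2 * t)"
          unfolding r_def using MaxE by (intro mult_left_mono) auto
        then show ?thesis by (simp add: obj_def algebra_simps)
      qed
      also have "obj v c' \<le> (1 + \<epsilon>) * obj v c" unfolding c'_def by (rule dec)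
      also have "(1 + \<epsilon>) * obj v c \<le> (1 + \<epsilon>) * (l1 c + 32 * (sqrt (real s) * t))"
        using objc \<epsilon>0 by (intro mult_left_mono) auto
      also have "(1 + \<epsilon>) * (l1 c + 32 * (sqrt (real s) * t)) =
          l1 c + \<epsilon> * l1 c + (1 + \<epsilon>) * (32 * (sqrt (real s) * t))" by (simp add: algebra_simps)
      also have "(1 + \<epsilon>) * (32 * (sqrt (real s) * t)) \<le> 2 * (32 * (sqrt (real s) * t))"
        using \<epsilon>1 t0 by (intro mult_right_mono) auto
      finally show ?thesis by (simp add: algebra_simps)
    qed
    have "(\<Sum>k\<le>N. \<bar>c k - c' k\<bar>) \<le> 2 * (2 * (\<Sum>k\<in>{..N} - S. \<bar>c k\<bar>) + (\<epsilon> * l1 c + 96 * (sqrt (real s) * t)))"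
    proof (rule l1_decoding_error[OF _ S(1,2)])
      show "r \<ge> 0" unfolding r_def by (intro mult_nonneg_nonneg Max_ge) auto
      show "(\<Sum>k\<le>N. \<bar>c' k\<bar>) + r \<le> (\<Sum>k\<le>N. \<bar>c k\<bar>) + (\<epsilon> * l1 c + 96 * (sqrt (real s) * t))"
        using h by (simp add: l1_def)
      show "2 * sqrt (real s) * L2_set (\<lambda>k. c k - c' k) {..N} \<le> r"
        if le: "(\<Sum>k\<le>N. \<bar>c k - c' k\<bar>) \<le> 4 * sqrt (real s) * L2_set (\<lambda>k. c k - c' k) {..N}"
      proof -
        obtain x where x: "x \<in> set xs" "L2_set d {..N} / 8 \<le> \<bar>F d x\<bar>"
          using low[of d] le unfolding d_def F_def by blast
        have "\<bar>F d x\<bar> \<le> Max (insert 0 ((\<lambda>x. \<bar>F d x\<bar>) ` set xs))" using x(1) by (intro Max_ge) auto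
        then have "16 * sqrt (real s) * (L2_set d {..N} / 8) \<le> r"
          unfolding r_def using x(2) by (intro mult_left_mono) auto
        moreover have "d = (\<lambda>k. c k - c' k)" by (auto simp: d_def)
        ultimately show ?thesis by simp
      qed
    qed simp
    also have "\<dots> \<le> 2 * (2 * (\<epsilon> * Q) + (\<epsilon> * Q + 96 * (\<epsilon> * W)))"
    proof -
      have "\<epsilon> * l1 c \<le> \<epsilon> * Q" using l1Q \<epsilon>0 by (intro mult_left_mono) auto
      then show ?thesis using S(3) tW l1Q \<epsilon>0 by (intro mult_left_mono add_mono) auto
    qed
    finally have e1: "(\<Sum>k\<le>N. \<bar>c k - c' k\<bar>) \<le> 6 * (\<epsilon> * Q) + 192 * (\<epsilon> * W)"
      by (simp add: algebra_simps)
    have "t \<le> sqrt (real s) * t" using s1 t0 mult_right_mono[of 1 "sqrt (real s)" t] by simp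
    then have e2: "t \<le> \<epsilon> * W" using tW by linarith
    have Q0: "\<epsilon> * Q \<ge> 0" using \<epsilon>0 by (simp add: QZ)
    have W0: "\<epsilon> * W \<ge> 0" using e2 t0 by linarith
    have "A_norm 1 (\<lambda>x. f x - poly (R v) x) = (\<Sum>k\<le>N. \<bar>c k - c' k\<bar>) + t"
      unfolding R_def c'_def[symmetric]
      by (subst A_norm_1) (auto simp: flcoeff_diff_legendre_sum[OF sm(1,2)] c_def t_def)
    \<comment> \<open>The coefficients are 6 for \<open>Q\<close> and 192 + 1 for \<open>W\<close>,
      the 1 coming from the tail itself.\<close>
    also have "\<dots> \<le> 200 * (Q + W) * \<epsilon>"
    proof -
      have "200 * (Q + W) * \<epsilon> = 200 * (\<epsilon> * Q) + 200 * (\<epsilon> * W)" by (simp add: algebra_simps)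
      then show ?thesis using e1 e2 Q0 W0 by linarith
    qed
    finally show ?thesis by (simp add: Q_def W_def \<epsilon>_def v_def)
  qed
  moreover have "degree (R v) \<le> N" for v unfolding R_def by (rule degree_legendre_sum)
  ultimately show ?thesis by (intro exI[of _ R]) auto
qed


section \<open>Orthonormality in the angle variable\<close>

definition angle_measure :: "real measure" where
  "angle_measure = density lborel (\<lambda>\<theta>. ennreal (indicator {0..pi} \<theta> / pi))"

lemma prob_space_angle_measure: "prob_space angle_measure"
proof
  have "emeasure angle_measure (space angle_measure) = (\<integral>\<^sup>+\<theta>. ennreal (1 / pi) * indicator {0..pi} \<theta> \<partial>lborel)"
    unfolding angle_measure_def
    by (subst emeasure_density) (auto intro!: nn_integral_cong simp: indicator_def)
  also have "\<dots> = ennreal (1 / pi) * ennreal pi"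
    by (subst nn_integral_cmult_indicator) auto
  also have "\<dots> = 1" by (subst ennreal_mult[symmetric]) auto
  finally show "emeasure angle_measure (space angle_measure) = 1" .
qed

lemma integral_angle_measure:
  fixes h :: "real \<Rightarrow> real"
  assumes "h \<in> borel_measurable borel" "continuous_on {0..pi} h"
  shows "(\<integral>\<theta>. h \<theta> \<partial>angle_measure) = integral {0..pi} h / pi"
proof -
  have "(\<integral>\<theta>. h \<theta> \<partial>angle_measure) = (\<integral>\<theta>. (indicator {0..pi} \<theta> / pi) *\<^sub>R h \<theta> \<partial>lborel)"
    unfolding angle_measure_def using assms(1) by (subst integral_density) auto
  also have "\<dots> = (\<integral>\<theta>. (indicator {0..pi} \<theta> *\<^sub>R h \<theta>) / pi \<partial>lborel)"
    by (intro Bochner_Integration.integral_cong) auto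
  also have "\<dots> = (LINT \<theta>:{0..pi}|lborel. h \<theta>) / pi"
    unfolding set_lebesgue_integral_def by simp
  also have "(LINT \<theta>:{0..pi}|lborel. h \<theta>) = integral {0..pi} h"
    using borel_integrable_atLeastAtMost'[OF assms(2)] by (rule set_borel_integral_eq_integral)
  finally show ?thesis .
qed

text \<open>The weight cancels the arcsine density:
  \<open>w(x)\<^sup>2 dx / (pi sqrt (1 - x\<^sup>2)) = dx / 2\<close>. The angle keeps the integrand
  free of end-point singularities, and \<open>- cos\<close> rather than \<open>cos\<close> makes the
  substitution increasing.\<close>

lemma legendre_orthonormal_angle:
  "(\<integral>\<theta>. (wgt (- cos \<theta>) * legendreL k (- cos \<theta>)) * (wgt (- cos \<theta>) * legendreL j (- cos \<theta>)) \<partial>angle_measure)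
     = of_bool (k = j)"
proof -
  let ?h = "\<lambda>\<theta>. (wgt (- cos \<theta>) * legendreL k (- cos \<theta>)) * (wgt (- cos \<theta>) * legendreL j (- cos \<theta>))"
  have c: "continuous_on A (\<lambda>\<theta>. legendreL k (- cos \<theta>))" for A k
    by (rule continuous_on_compose2[of UNIV "legendreL k"]) (auto intro!: continuous_intros)
  have cw: "continuous_on UNIV (\<lambda>\<theta>. wgt (- cos \<theta>))"
    by (rule continuous_on_compose2[of "{-1..1}" wgt]) (auto intro!: continuous_intros simp: minus_le_iff)
  have ch: "continuous_on UNIV ?h" by (intro continuous_intros c cw)
  have "?h \<in> borel_measurable borel" using ch by (rule borel_measurable_continuous_onI)
  then have "(\<integral>\<theta>. ?h \<theta> \<partial>angle_measure) = integral {0..pi} ?h / pi"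
    using ch by (intro integral_angle_measure) (auto intro: continuous_on_subset)
  also have "integral {0..pi} ?h =
      integral {0..pi} (\<lambda>\<theta>. pi / 2 * (sin \<theta> *\<^sub>R (legendreL k (- cos \<theta>) * legendreL j (- cos \<theta>))))"
  proof (rule integral_cong)
    fix \<theta> assume "\<theta> \<in> {0..pi}"
    then have "sin \<theta> \<ge> 0" by (auto intro: sin_ge_zero)
    then have "sqrt (1 - (- cos \<theta>)\<^sup>2) = sin \<theta>" by (simp add: sin_squared_eq[symmetric])
    then have "(wgt (- cos \<theta>))\<^sup>2 = pi / 2 * sin \<theta>" by (subst wgt_square) (auto simp: abs_cos_le_one)
    then show "?h \<theta> = pi / 2 * (sin \<theta> *\<^sub>R (legendreL k (- cos \<theta>) * legendreL j (- cos \<theta>)))"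
      by (simp add: power2_eq_square)
  qed
  also have "\<dots> = pi / 2 * integral {0..pi} (\<lambda>\<theta>. sin \<theta> *\<^sub>R (legendreL k (- cos \<theta>) * legendreL j (- cos \<theta>)))"
    by (rule integral_mult_right)
  also have "integral {0..pi} (\<lambda>\<theta>. sin \<theta> *\<^sub>R (legendreL k (- cos \<theta>) * legendreL j (- cos \<theta>))) =
      integral {- cos 0..- cos pi} (\<lambda>x. legendreL k x * legendreL j x)"
  proof (rule integral_unique, rule has_integral_substitution[where c = "-1" and d = 1])
    show "(\<lambda>\<theta>. - cos \<theta>) ` {0..pi} \<subseteq> {-1..1}" by (auto simp: minus_le_iff)
    show "((\<lambda>\<theta>. - cos \<theta>) has_real_derivative sin x) (at x within {0..pi})" for x :: real
      by (auto intro!: derivative_eq_intros)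
  qed (auto intro!: continuous_intros)
  also have "\<dots> = (if k = j then 2 else 0)" using legendreL_integral[of k j] by simp
  finally show ?thesis by auto
qed

lemma legendre_sampling_points:
  fixes s N m :: nat
  assumes s: "s \<ge> 2" and m: "real m \<ge> 3072000000 * real s * (ln (real s))\<^sup>2 * ln (2 * (real N + 1))"
  shows "\<exists>xs. length xs = m \<and> set xs \<subseteq> {-1..1} \<and>
    (\<forall>c. (\<Sum>k\<le>N. \<bar>c k\<bar>) \<le> 4 * sqrt (real s) * L2_set c {..N} \<longrightarrow>
       (\<exists>x\<in>set xs. L2_set c {..N} / 8 \<le> \<bar>\<Sum>k\<le>N. c k * (wgt x * legendreL k x)\<bar>))"
proof -
  interpret prob_space angle_measure by (rule prob_space_angle_measure)
  define \<phi> where "\<phi> k \<theta> = wgt (- cos \<theta>) * legendreL k (- cos \<theta>)" for k \<theta>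
  define A where "A = 4 * sqrt (real s)"
  define b where "b = A * sqrt 3"
  have b2: "b\<^sup>2 = 48 * real s" by (simp add: b_def A_def power_mult_distrib)
  have b0: "b > 0" using s by (simp add: b_def A_def)
  have b: "b \<ge> 2"
  proof (rule power2_le_imp_le)
    show "2\<^sup>2 \<le> b\<^sup>2" unfolding b2 using s by simp
  qed (use b0 in simp)
  have lns: "ln (real s) \<ge> ln 2" using s by simp
  have ln2: "ln 2 > (0::real)" by simp
  have lnb: "ln b \<le> 4 * ln (real s)"
  proof -
    have "2 * ln b = ln (b\<^sup>2)" using b0 by (simp add: ln_realpow)
    also have "\<dots> \<le> ln (2 ^ 6 * real s)" unfolding b2 using s by simp
    also have "\<dots> = ln (2 ^ 6) + ln (real s)" using s by (subst ln_mult) auto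
    also have "ln (2 ^ 6 :: real) = 6 * ln 2" by (subst ln_realpow) auto
    finally show ?thesis using lns ln2 by linarith
  qed
  have lnb0: "ln b \<ge> 0" using b by simp
  have Y0: "ln (2 * (real N + 1)) \<ge> 0" by (rule ln_ge_zero) simp
  \<comment> \<open>With \<open>b\<^sup>2 = 48 * s\<close> and \<open>ln b \<le> 4 * ln s\<close>
    the constant becomes 4000000 * 48 * 16 = 3072000000.\<close>
  have "4000000 * b\<^sup>2 * (ln b)\<^sup>2 * ln (2 * (real N + 1)) \<le>
      4000000 * (48 * real s) * (4 * ln (real s))\<^sup>2 * ln (2 * (real N + 1))"
    unfolding b2 using lnb lnb0 Y0 by (intro mult_right_mono mult_left_mono power_mono) auto
  also have "\<dots> = 3072000000 * real s * (ln (real s))\<^sup>2 * ln (2 * (real N + 1))"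
    by (simp add: power_mult_distrib)
  also note m
  finally have mb: "4000000 * b\<^sup>2 * (ln b)\<^sup>2 * ln (2 * (real N + 1)) \<le> real m" .
  have m0: "m > 0"
  proof -
    have "ln (2 * (real N + 1)) > 0" by (rule ln_gt_zero) simp
    then have "3072000000 * real s * (ln (real s))\<^sup>2 * ln (2 * (real N + 1)) > 0"
      using lns ln2 s by (intro mult_pos_pos) auto
    then show ?thesis using m by linarith
  qed
  have "\<exists>x. (\<forall>j<m. x j \<in> space angle_measure) \<and>
    (\<forall>c. (\<Sum>k\<le>N. (c k)\<^sup>2) = 1 \<and> (\<Sum>k\<le>N. \<bar>c k\<bar>) \<le> A \<longrightarrow>
       (\<exists>j<m. 1/4 \<le> \<bar>\<Sum>k\<le>N. c k * \<phi> k (x j)\<bar>))"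
  proof (rule bounded_orthonormal_system_points[OF _ _ _ _ _ b_def b mb])
    show "\<phi> k \<in> borel_measurable angle_measure" for k
    proof -
      have [measurable]: "legendreL k \<in> borel_measurable borel"
        by (intro borel_measurable_continuous_onI continuous_intros)
      have [measurable]: "wgt \<in> borel_measurable borel" unfolding wgt_def by measurable
      have "\<phi> k \<in> borel_measurable borel" unfolding \<phi>_def by measurable
      then show ?thesis by (simp add: angle_measure_def)
    qed
    show "\<bar>\<phi> k y\<bar> \<le> sqrt 3" for k y unfolding \<phi>_def by (rule wgt_legendreL_le) (simp add: abs_cos_le_one)
    show "(\<integral>y. \<phi> k y * \<phi> j y \<partial>angle_measure) = of_bool (k = j)" for k j
      unfolding \<phi>_def by (rule legendre_orthonormal_angle)
    show "A > 0" using s by (simp add: A_def)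
  qed simp
  then obtain \<theta> where \<theta>: "\<And>c. (\<Sum>k\<le>N. (c k)\<^sup>2) = 1 \<Longrightarrow> (\<Sum>k\<le>N. \<bar>c k\<bar>) \<le> A \<Longrightarrow>
       (\<exists>j<m. 1/4 \<le> \<bar>\<Sum>k\<le>N. c k * \<phi> k (\<theta> j)\<bar>)" by blast
  define xs where "xs = map (\<lambda>j. - cos (\<theta> j)) [0..<m]"
  have "\<exists>x\<in>set xs. L2_set c {..N} / 8 \<le> \<bar>\<Sum>k\<le>N. c k * (wgt x * legendreL k x)\<bar>"
    if c: "(\<Sum>k\<le>N. \<bar>c k\<bar>) \<le> 4 * sqrt (real s) * L2_set c {..N}" for c
  proof (cases "L2_set c {..N} = 0")
    case True
    \<comment> \<open>For the zero vector any sampling point will do; there is one because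
      \<open>m > 0\<close>.\<close>
    have "- cos (\<theta> 0) \<in> set xs" using m0 by (auto simp: xs_def)
    then show ?thesis unfolding True by (intro bexI) auto
  next
    case False
    define n where "n = L2_set c {..N}"
    have n: "n > 0" using False by (simp add: n_def L2_set_nonneg order_less_le)
    have "(\<Sum>k\<le>N. (c k)\<^sup>2) = n\<^sup>2" by (simp add: n_def L2_set_def sum_nonneg)
    then have "(\<Sum>k\<le>N. (c k / n)\<^sup>2) = 1" using n by (simp add: power_divide flip: sum_divide_distrib)
    moreover have "(\<Sum>k\<le>N. \<bar>c k / n\<bar>) \<le> A"
      using c n by (simp add: A_def n_def[symmetric] pos_divide_le_eq flip: sum_divide_distrib)
    ultimately obtain j where j: "j < m" "1/4 \<le> \<bar>\<Sum>k\<le>N. c k / n * \<phi> k (\<theta> j)\<bar>"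
      using \<theta>[of "\<lambda>k. c k / n"] by blast
    have "(\<Sum>k\<le>N. c k / n * \<phi> k (\<theta> j)) = (\<Sum>k\<le>N. c k * \<phi> k (\<theta> j)) / n"
      by (simp add: sum_divide_distrib)
    with j(2) have "1/4 \<le> \<bar>\<Sum>k\<le>N. c k * \<phi> k (\<theta> j)\<bar> / n" using n by simp
    then have "n / 4 \<le> \<bar>\<Sum>k\<le>N. c k * \<phi> k (\<theta> j)\<bar>" using n by (simp add: pos_le_divide_eq mult.commute)
    \<comment> \<open>Weakened from 1/4 to 1/8 so that one constant serves this case and the
      quadratic one.\<close>
    then have "n / 8 \<le> \<bar>\<Sum>k\<le>N. c k * \<phi> k (\<theta> j)\<bar>" using n by linarith
    moreover have "- cos (\<theta> j) \<in> set xs" using j(1) by (auto simp: xs_def)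
    ultimately show ?thesis unfolding n_def \<phi>_def by blast
  qed
  moreover have "length xs = m" "set xs \<subseteq> {-1..1}" by (auto simp: xs_def minus_le_iff)
  ultimately show ?thesis by blast
qed

section \<open>Reconstruction from few points\<close>

lemma wgt_ge_1:
  assumes "\<bar>x\<bar> \<le> 1 / 2"
  shows "wgt x \<ge> 1"
proof (rule power2_le_imp_le)
  have "x\<^sup>2 \<le> (1 / 2)\<^sup>2" using assms by (intro abs_le_square_iff[THEN iffD1]) simp
  then have "sqrt ((3 / 4)\<^sup>2) \<le> sqrt (1 - x\<^sup>2)" by (intro real_sqrt_le_mono) (simp add: power2_eq_square)
  then have "3 / 2 * (3 / 4) \<le> pi / 2 * sqrt (1 - x\<^sup>2)" using pi_gt3 by (intro mult_mono) auto
  then show "1\<^sup>2 \<le> (wgt x)\<^sup>2" using assms by (subst wgt_square) auto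
qed simp

lemma legendre_points_constant:
  assumes "0 \<in> set xs"
  shows "\<exists>x\<in>set xs. L2_set c {..0} / 8 \<le> \<bar>\<Sum>k\<le>0. c k * (wgt x * legendreL k x)\<bar>"
proof (rule bexI[OF _ assms])
  have "\<bar>c 0\<bar> * 1 \<le> \<bar>c 0\<bar> * wgt 0" by (intro mult_left_mono wgt_ge_1) auto
  then show "L2_set c {..0} / 8 \<le> \<bar>\<Sum>k\<le>0. c k * (wgt 0 * legendreL k 0)\<bar>"
    by (simp add: legendreL_def abs_mult L2_set_def)
qed

text \<open>The weight is at least 1 at the three nodes and may be dropped there. If all three
  values were below \<open>n / 8\<close>, the difference of the outer ones would bound
  \<open>c 1\<close>, the second difference \<open>c 2\<close>, and then \<open>f 0\<close> would
  bound \<open>c 0\<close>; the squares would add up to at most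
  \<open>221 / 576 * n\<^sup>2\<close>, less than \<open>n\<^sup>2\<close>.\<close>

lemma legendre_points_quadratic:
  fixes c :: "nat \<Rightarrow> real"
  assumes "{- 1/2, 0, 1/2} \<subseteq> set xs"
  shows "\<exists>x\<in>set xs. L2_set c {..2} / 8 \<le> \<bar>\<Sum>k\<le>2. c k * (wgt x * legendreL k x)\<bar>"
proof (rule ccontr)
  assume neg: "\<not> ?thesis"
  define n where "n = L2_set c {..2}"
  define f where "f x = (\<Sum>k\<le>2. c k * legendreL k x)" for x
  have small: "\<bar>f x\<bar> < n / 8" if "x \<in> {- 1/2, 0, 1/2}" for x
  proof -
    have "\<bar>f x\<bar> * 1 \<le> \<bar>f x\<bar> * wgt x" using that by (intro mult_left_mono wgt_ge_1) auto
    also have "\<dots> = \<bar>\<Sum>k\<le>2. c k * (wgt x * legendreL k x)\<bar>"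
    proof -
      have "(\<Sum>k\<le>2. c k * (wgt x * legendreL k x)) = f x * wgt x"
        unfolding f_def sum_distrib_right by (intro sum.cong) auto
      then show ?thesis by (simp add: abs_mult)
    qed
    also have "\<dots> < n / 8"
    proof -
      have "x \<in> set xs" using that assms by blast
      then show ?thesis using neg unfolding n_def not_le[symmetric] by blast
    qed
    finally show ?thesis by simp
  qed
  have f: "f x = c 0 + c 1 * (sqrt 3 * x) + c 2 * (sqrt 5 * ((3 * x\<^sup>2 - 1) / 2))" for x
    unfolding f_def by (simp add: numeral_2_eq_2 legendreL_def power2_eq_square algebra_simps)
  have f0: "f 0 = c 0 - c 2 * sqrt 5 / 2" by (simp add: f)
  have fp: "f (1/2) = c 0 + c 1 * sqrt 3 / 2 - c 2 * sqrt 5 / 8" by (simp add: f power2_eq_square)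
  have fm: "f (- 1/2) = c 0 - c 1 * sqrt 3 / 2 - c 2 * sqrt 5 / 8" by (simp add: f power2_eq_square)
  have sm: "\<bar>f 0\<bar> < n / 8" "\<bar>f (1/2)\<bar> < n / 8" "\<bar>f (- 1/2)\<bar> < n / 8"
    by (rule small; simp)+
  have "\<bar>c 1 * sqrt 3\<bar> < n / 4" using sm fp fm by linarith
  moreover have "\<bar>c 1\<bar> * 1 \<le> \<bar>c 1\<bar> * sqrt 3" by (intro mult_left_mono) auto
  ultimately have c1: "\<bar>c 1\<bar> < n / 4" by (simp add: abs_mult)
  have d2: "3 / 8 * \<bar>c 2 * sqrt 5\<bar> < n / 4" using sm fp fm f0 by linarith
  moreover have "\<bar>c 2\<bar> * 2 \<le> \<bar>c 2\<bar> * sqrt 5" by (intro mult_left_mono real_le_rsqrt) auto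
  ultimately have c2: "\<bar>c 2\<bar> < n / 3" by (simp add: abs_mult)
  have c0: "\<bar>c 0\<bar> < n / 8 + n / 3" using sm f0 d2 by linarith
  have "n\<^sup>2 = (c 0)\<^sup>2 + (c 1)\<^sup>2 + (c 2)\<^sup>2"
    by (simp add: n_def L2_set_def numeral_2_eq_2)
  moreover have "(c 1)\<^sup>2 \<le> (n / 4)\<^sup>2" using c1 by (intro abs_le_square_iff[THEN iffD1]) linarith
  moreover have "(c 2)\<^sup>2 \<le> (n / 3)\<^sup>2" using c2 by (intro abs_le_square_iff[THEN iffD1]) linarith
  moreover have "(c 0)\<^sup>2 \<le> (n / 8 + n / 3)\<^sup>2" using c0 by (intro abs_le_square_iff[THEN iffD1]) linarith
  ultimately have "n\<^sup>2 \<le> (n / 8 + n / 3)\<^sup>2 + (n / 4)\<^sup>2 + (n / 3)\<^sup>2" by linarith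
  moreover have "n > 0" using c1 by (simp add: order_le_less_trans[OF abs_ge_zero])
  then have "n\<^sup>2 > 0" by simp
  moreover have "(n / 8 + n / 3)\<^sup>2 + (n / 4)\<^sup>2 + (n / 3)\<^sup>2 = 221 / 576 * n\<^sup>2"
    by (simp add: power2_eq_square algebra_simps)
  ultimately show False by linarith
qed

text \<open>Serves the case \<open>s = 1\<close>, where the reconstruction is the zero
  polynomial.\<close>

lemma A_norm_1_le:
  assumes q: "0 < q" "q < 1" and f: "f \<in> A_space q" and sm: "summable (\<lambda>k. \<bar>flcoeff f k\<bar>)"
  shows "A_norm 1 f \<le> A_norm q f"
  unfolding A_norm_1[OF sm]
proof (rule suminf_le_const[OF sm])
  fix n
  show "(\<Sum>k<n. \<bar>flcoeff f k\<bar>) \<le> A_norm q f"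
    unfolding A_norm_def by (intro sum_abs_le_quasinorm A_space_partial_sum q f) auto
qed

text \<open>If \<open>s\<^sup>t < 2\<close>, then \<open>N = 2\<close> but the hypothesis may allow fewer points than \<open>bounded_orthonormal_system_points\<close>
  requires; one recovers a quadratic polynomial from three points, or, when even \<open>m < 3\<close>, a constant.\<close>

lemma sampling_points_exist:
  fixes s m :: nat and t :: real
  assumes s: "s \<ge> 2" and t: "t > 0" and m: "real m \<ge> 20000000000 * t * real s * (ln (real s)) ^ 4"
  defines "N \<equiv> nat \<lceil>real s powr t\<rceil>"
  shows "\<exists>N' xs. N' \<le> N \<and> real s powr t \<le> real N' + 2 \<and> length xs = m \<and> set xs \<subseteq> {-1..1} \<and>
    (\<forall>c. (\<Sum>k\<le>N'. \<bar>c k\<bar>) \<le> 4 * sqrt (real s) * L2_set c {..N'} \<longrightarrow>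
       (\<exists>x\<in>set xs. L2_set c {..N'} / 8 \<le> \<bar>\<Sum>k\<le>N'. c k * (wgt x * legendreL k x)\<bar>))"
proof -
  have lns: "ln (real s) \<ge> 2/3"
  proof -
    have "ln 2 \<le> ln (real s)" using s by simp
    then show ?thesis using ln2_ge_two_thirds by linarith
  qed
  define T where "T = real s powr t"
  have lnT: "ln T = t * ln (real s)" using s by (simp add: T_def ln_powr)
  have T1: "T > 1" unfolding T_def using s t by (intro gr_one_powr) auto
  have NT: "T \<le> real N" "real N \<le> T + 1" unfolding N_def T_def[symmetric] using T1 by linarith+
  have N2: "N \<ge> 2" using NT T1 by linarith
  \<comment> \<open>Two logarithms go to \<open>legendre_sampling_points\<close> and one is
    \<open>ln T = t * ln s\<close>; the remaining one is at least 2/3, and 20000000000 * 2/3 covers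
    3 * 3072000000.\<close>
  have m': "20000000000 * t * real s * (ln (real s)) ^ 4 = 20000000000 * ln (real s) * (real s * (ln (real s))\<^sup>2 * ln T)"
    unfolding lnT by (simp add: power4_eq_xxxx power2_eq_square)
  show ?thesis
  \<comment> \<open>For \<open>T \<ge> 2\<close> one has
    \<open>2 * (N + 1) \<le> 2 * T + 4 \<le> T ^ 3\<close>, so \<open>ln (2 * (N + 1))\<close> is at
    most \<open>3 * ln T\<close>. Near \<open>T = 1\<close> no such comparison is possible, since
    \<open>ln T\<close> tends to 0.\<close>
  proof (cases "T \<ge> 2")
    case True
    have "ln (2 * (real N + 1)) \<le> ln (T ^ 3)"
    proof (subst ln_le_cancel_iff)
      have "2 * 2 \<le> T * T" using True by (intro mult_mono) auto
      then have "4 * T \<le> T ^ 3" using True by (simp add: power3_eq_cube)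
      then have "2 * real N + 2 \<le> T ^ 3" using NT True by linarith
      then show "2 * (real N + 1) \<le> T ^ 3" by simp
    qed (use T1 in auto)
    also have "\<dots> = 3 * ln T" using T1 by (simp add: ln_realpow)
    finally have Y: "ln (2 * (real N + 1)) \<le> 3 * ln T" .
    have pos: "real s * (ln (real s))\<^sup>2 * ln T \<ge> 0" using T1 by simp
    have "3072000000 * real s * (ln (real s))\<^sup>2 * ln (2 * (real N + 1)) \<le>
        3072000000 * real s * (ln (real s))\<^sup>2 * (3 * ln T)"
      using Y by (intro mult_left_mono) auto
    also have "\<dots> = 9216000000 * (real s * (ln (real s))\<^sup>2 * ln T)" by simp
    also have "\<dots> \<le> (20000000000 * ln (real s)) * (real s * (ln (real s))\<^sup>2 * ln T)"
      using lns pos by (intro mult_right_mono) auto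
    also have "\<dots> \<le> real m" using m unfolding m' .
    finally have "3072000000 * real s * (ln (real s))\<^sup>2 * ln (2 * (real N + 1)) \<le> real m" .
    from legendre_sampling_points[OF s this] obtain xs where
      "length xs = m" "set xs \<subseteq> {-1..1}"
      "\<forall>c. (\<Sum>k\<le>N. \<bar>c k\<bar>) \<le> 4 * sqrt (real s) * L2_set c {..N} \<longrightarrow>
       (\<exists>x\<in>set xs. L2_set c {..N} / 8 \<le> \<bar>\<Sum>k\<le>N. c k * (wgt x * legendreL k x)\<bar>)" by blast
    moreover have "real s powr t \<le> real N + 2" using NT unfolding T_def by linarith
    ultimately show ?thesis by blast
  next
    case False
    then have T2: "real s powr t \<le> 2" by (simp add: T_def)
    have "real m > 0"
    proof -
      have "20000000000 * ln (real s) * (real s * (ln (real s))\<^sup>2 * ln T) > 0"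
        using lns s T1 by simp
      then show ?thesis using m unfolding m' by linarith
    qed
    then have m1: "m \<ge> 1" by simp
    show ?thesis
    proof (cases "m \<ge> 3")
      case True
      define xs where "xs = [- 1/2, 0, 1/2] @ replicate (m - 3) (0::real)"
      have "length xs = m" "set xs \<subseteq> {-1..1}" "{- 1/2, 0, 1/2} \<subseteq> set xs"
        using True by (auto simp: xs_def)
      moreover have "real s powr t \<le> real 2 + 2" using T2 by simp
      ultimately show ?thesis using N2 legendre_points_quadratic by blast
    next
      case False
      have "length (replicate m (0::real)) = m" "set (replicate m (0::real)) \<subseteq> {-1..1}" "0 \<in> set (replicate m (0::real))"
        using m1 by auto
      moreover have "real s powr t \<le> real 0 + 2" using T2 by simp
      ultimately show ?thesis using legendre_points_constant by blast
    qed
  qed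
qed

theorem theorem7p2:
  shows "\<exists>C C' :: real. C > 0 \<and> C' > 0 \<and>
    (\<forall>(q::real) (\<alpha>::real) (m::nat) (s::nat).
       0 < q \<and> q < 1 \<and> \<alpha> > 0 \<and> s \<ge> 1 \<and>
       real m \<ge> C / \<alpha> * (1/q - 1/2) * real s * (ln (real s)) ^ 4 \<longrightarrow>
       (let N = nat \<lceil>real s powr ((1/q - 1/2) / \<alpha>)\<rceil> in
        \<exists>(xs :: real list) (R :: real list \<Rightarrow> real poly).
          length xs = m \<and> set xs \<subseteq> {-1..1} \<and>
          (\<forall>v. length v = m \<longrightarrow> degree (R v) \<le> N) \<and>
          (\<forall>f. f \<in> A_space q \<inter> A1w_space \<alpha> \<longrightarrow>
             (let P = R (map f xs); g = (\<lambda>x. f x - poly P x) in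
                1 / sqrt 3 * wsup_norm g \<le> A_norm 1 g \<and>
                A_norm 1 g \<le> C' * (A_norm q f + A1w_norm \<alpha> f) * real s powr (1 - 1/q)))))"
proof (rule exI[of _ 20000000000], rule exI[of _ 200], intro conjI allI impI)
  fix q \<alpha> :: real and m s :: nat
  assume A: "0 < q \<and> q < 1 \<and> \<alpha> > 0 \<and> s \<ge> 1 \<and>
       real m \<ge> 20000000000 / \<alpha> * (1/q - 1/2) * real s * (ln (real s)) ^ 4"
  then have q: "0 < q" "q < 1" and \<alpha>: "\<alpha> > 0" and s: "s \<ge> 1" by auto
  define t where "t = (1/q - 1/2) / \<alpha>"
  define N where "N = nat \<lceil>real s powr t\<rceil>"
  have "1 / q > 1" using q by simp
  then have t: "t > 0" using \<alpha> by (simp add: t_def)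
  have main: "\<exists>xs R. length xs = m \<and> set xs \<subseteq> {-1..1} \<and> (\<forall>v. degree (R v) \<le> N) \<and>
      (\<forall>f\<in>A_space q \<inter> A1w_space \<alpha>. A_norm 1 (\<lambda>x. f x - poly (R (map f xs)) x)
        \<le> 200 * (A_norm q f + A1w_norm \<alpha> f) * real s powr (1 - 1/q))"
  \<comment> \<open>For \<open>s = 1\<close> the logarithm vanishes, so \<open>m\<close> may be 0;
    the claimed rate is then 1 and \<open>P = 0\<close> suffices.\<close>
  proof (cases "s = 1")
    case True
    have "A_norm 1 f \<le> 200 * (A_norm q f + A1w_norm \<alpha> f)" if f: "f \<in> A_space q" "f \<in> A1w_space \<alpha>" for f
    proof -
      note sm = A1w_space_summable[OF f(2) \<alpha>]
      have "A_norm 1 f \<le> A_norm q f" by (rule A_norm_1_le[OF q f(1) sm(2)])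
      moreover have "A_norm q f \<ge> 0" by (simp add: A_norm_def)
      moreover have "A1w_norm \<alpha> f \<ge> 0" unfolding A1w_norm_def by (rule suminf_nonneg[OF sm(3)]) simp
      ultimately have "A_norm 1 f \<le> 200 * A_norm q f + 200 * A1w_norm \<alpha> f" by linarith
      then show ?thesis by simp
    qed
    then show ?thesis unfolding True
      by (intro exI[of _ "replicate m 0"] exI[of _ "\<lambda>_. 0"]) auto
  next
    case False
    then have s2: "s \<ge> 2" using s by simp
    have "real m \<ge> 20000000000 * t * real s * (ln (real s)) ^ 4" using A by (simp add: t_def)
    from sampling_points_exist[OF s2 t this] obtain N' xs where
      N': "N' \<le> N" "real s powr t \<le> real N' + 2" and xs: "length xs = m" "set xs \<subseteq> {-1..1}" and
      low: "\<And>c. (\<Sum>k\<le>N'. \<bar>c k\<bar>) \<le> 4 * sqrt (real s) * L2_set c {..N'} \<Longrightarrow>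
       \<exists>x\<in>set xs. L2_set c {..N'} / 8 \<le> \<bar>\<Sum>k\<le>N'. c k * (wgt x * legendreL k x)\<bar>"
      unfolding N_def by blast
    from legendre_decoder[OF q \<alpha> s xs(2) low N'(2)[unfolded t_def]] obtain R where
      "\<forall>v. degree (R v) \<le> N'"
      "\<forall>f\<in>A_space q \<inter> A1w_space \<alpha>. A_norm 1 (\<lambda>x. f x - poly (R (map f xs)) x)
        \<le> 200 * (A_norm q f + A1w_norm \<alpha> f) * real s powr (1 - 1/q)" by blast
    moreover from this N'(1) have "\<forall>v. degree (R v) \<le> N" by (blast intro: order_trans)
    ultimately show ?thesis using xs by blast
  qed
  then obtain xs R where xs: "length xs = m" "set xs \<subseteq> {-1..1}" and deg: "\<And>v. degree (R v) \<le> N" and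
    err: "\<And>f. f \<in> A_space q \<inter> A1w_space \<alpha> \<Longrightarrow> A_norm 1 (\<lambda>x. f x - poly (R (map f xs)) x)
        \<le> 200 * (A_norm q f + A1w_norm \<alpha> f) * real s powr (1 - 1/q)" by blast
  have wsup: "1 / sqrt 3 * wsup_norm (\<lambda>x. f x - poly (R v) x) \<le> A_norm 1 (\<lambda>x. f x - poly (R v) x)"
    if "f \<in> A1w_space \<alpha>" for f v
  proof -
    note sm = A1w_space_summable[OF that \<alpha>]
    obtain a where a: "R v = legendre_sum a N" using legendre_span[OF deg] unfolding legendre_sum_def by blast
    show ?thesis unfolding a
      by (intro wsup_norm_le_A_norm flcoeff_diff_legendre_sum continuous_intros sm)
  qed
  show "let N = nat \<lceil>real s powr ((1/q - 1/2) / \<alpha>)\<rceil> in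
        \<exists>(xs :: real list) (R :: real list \<Rightarrow> real poly).
          length xs = m \<and> set xs \<subseteq> {-1..1} \<and>
          (\<forall>v. length v = m \<longrightarrow> degree (R v) \<le> N) \<and>
          (\<forall>f. f \<in> A_space q \<inter> A1w_space \<alpha> \<longrightarrow>
             (let P = R (map f xs); g = (\<lambda>x. f x - poly P x) in
                1 / sqrt 3 * wsup_norm g \<le> A_norm 1 g \<and>
                A_norm 1 g \<le> 200 * (A_norm q f + A1w_norm \<alpha> f) * real s powr (1 - 1/q)))"
    unfolding Let_def t_def[symmetric] N_def[symmetric]
    using xs deg err wsup by (intro exI[of _ xs] exI[of _ R]) auto
qed auto

end
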